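(* Let $f:\mathbb{R}\to\mathbb{C}$ be a bounded continuous function with $f(0)=1$. For $z\in\mathbb{C}\setminus\mathbb{R}$ define the modified Cauchy transform \[ K_f(z)=\frac{i}{\pi}\int_{-\infty}^{\infty}\Bigl(\frac{1}{z-t}+\frac{t}{t^2+1}\Bigr)f(t)\,dt . \] Then $f$ is a characteristic function if and only if there is a constant $a_f\in\mathbb{R}$ such that: (i) the function $y\mapsto a_f+K_f(iy)$ is completely monotonic on $(0,\infty)$, and (ii) the function $y\mapsto -\bigl(a_f+K_f(iy)\bigr)$ is absolutely monotonic on $(-\infty,0)$.
   Context: A function $f:\mathbb{R}\to\mathbb{C}$ is a characteristic function if there is a probability measure $\sigma$ on $\mathbb{R}$ with $f(x)=\int_{-\infty}^{\infty}e^{ixt}\,d\sigma(t)$ for all $x\in\mathbb{R}$. A function $\omega:(a,b)\to\mathbb{R}$ ($-\infty\le a<b\le\infty$) is completely monotonic if it is infinitely differentiable and $(-1)^n\omega^{(n)}(x)\ge 0$ for all $x\in(a,b)$ and all $n=0,1,2,\dots$. A function $\omega$ is absolutely monotonic on $(a,b)$ if $x\mapsto\omega(-x)$ is completely monotonic on $(-b,-a)$, equivalently $\omega$ is infinitely differentiable with $\omega^{(n)}(x)\ge0$ for all $x\in(a,b)$ and all $n\ge 0$. (In particular, conditions (i) and (ii) require the respective functions to be real-valued.) *)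

theory Defs
  imports "HOL-Probability.Probability"
begin

definition completely_monotonic_on :: "(real \<Rightarrow> real) \<Rightarrow> real set \<Rightarrow> bool" where
  "completely_monotonic_on \<omega> S \<longleftrightarrow>
     (\<exists>D :: nat \<Rightarrow> real \<Rightarrow> real.
        (\<forall>x\<in>S. D 0 x = \<omega> x) \<and>
        (\<forall>n. \<forall>x\<in>S. (D n has_real_derivative D (Suc n) x) (at x)) \<and>
        (\<forall>n. \<forall>x\<in>S. (-1) ^ n * D n x \<ge> 0))"

definition absolutely_monotonic_on :: "(real \<Rightarrow> real) \<Rightarrow> real set \<Rightarrow> bool" where
  "absolutely_monotonic_on \<omega> S \<longleftrightarrow> completely_monotonic_on (\<lambda>x. \<omega> (- x)) (uminus ` S)"

definition is_characteristic_function :: "(real \<Rightarrow> complex) \<Rightarrow> bool" where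
  "is_characteristic_function f \<longleftrightarrow>
     (\<exists>M. real_distribution M \<and> (\<forall>x. f x = char M x))"

definition modified_cauchy :: "(real \<Rightarrow> complex) \<Rightarrow> complex \<Rightarrow> complex" where
  "modified_cauchy f z = (\<i> / of_real pi) *
     (LINT t|lborel. (1 / (z - of_real t) + of_real (t / (t\<^sup>2 + 1))) * f t)"

end

theory Submission
  imports Defs "HOL-Complex_Analysis.Complex_Analysis" "HOL-Real_Asymp.Real_Asymp"
begin

text \<open>
  Write \<open>K\<close> for the modified Cauchy transform and \<open>P\<close> for the Poisson integral of \<open>f\<close>, so that
  \<open>K (p + \<i> x) - K (p - \<i> x) = 2 P (p + \<i> x)\<close> for \<open>x > 0\<close>.

  Sufficiency: \<open>F w = a + K (\<i> w)\<close> and \<open>G w = - (a + K (- \<i> w))\<close> are holomorphic on \<open>Re w > 0\<close>, and complete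
  monotonicity says that the Taylor coefficients of \<open>F (N (1 - u))\<close> and \<open>G (N (1 - u))\<close> at \<open>u = 0\<close> are
  nonnegative. As in Feller's proof of Bernstein's theorem, place half of these coefficients as masses at
  the points \<open>k / N\<close> and \<open>- k / N\<close>, respectively. By the jump relation the resulting
  measure has characteristic function \<open>s \<mapsto> P (N sin (s / N) + \<i> N (1 - cos (s / N)))\<close>. This is \<open>f 0 = 1\<close>
  at \<open>s = 0\<close> and tends to \<open>f s\<close> as \<open>N \<rightarrow> \<infinity>\<close>. The two-sided Laplace transforms of these measures are
  values of \<open>P\<close> on the imaginary axis as well, which gives tightness, and Helly's selection theorem finishes the proof.

  Necessity: Fourier inversion and Fubini turn \<open>K\<close> of the characteristic function of \<open>M\<close> into an explicit
  integral over \<open>M\<close>. For \<open>y > 0\<close> and \<open>a = \<integral> sgn s exp (- \<bar>s\<bar>) dM\<close> one finds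
  \<open>a + K (\<i> y) = \<integral> (1 + sgn s) exp (- y \<bar>s\<bar>) dM\<close> and
  \<open>- (a + K (- \<i> y)) = \<integral> (1 - sgn s) exp (- y \<bar>s\<bar>) dM\<close>.
\<close>

section \<open>Poisson integrals and the modified Cauchy transform\<close>

lemma integrable_Cauchy_kernel: "integrable lborel (\<lambda>t::real. 1 / (1 + t\<^sup>2))"
  and integral_Cauchy_kernel: "(LINT t|lborel. 1 / (1 + t\<^sup>2)) = pi"
  using integrable_inverse_1_plus_square LBINT_inverse_1_plus_square
  by (simp_all add: set_integrable_def interval_lebesgue_integral_def set_lebesgue_integral_def
        divide_inverse)

text \<open>Dominated convergence for the difference quotients, which the mean value inequality on
  the convex ball bounds by \<open>B\<close>. The field is generic because the lemma serves both
  complex differentiation of the Cauchy transform and real differentiation of Laplace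
  integrals.\<close>

lemma has_field_derivative_integral:
  fixes f f' :: "'b \<Rightarrow> 'a::{real_normed_field,banach,second_countable_topology} \<Rightarrow> 'a"
  assumes r: "r > 0"
    and int: "\<And>x. x \<in> ball z r \<Longrightarrow> integrable M (\<lambda>s. f s x)"
    and deriv: "\<And>s x. x \<in> ball z r \<Longrightarrow> (f s has_field_derivative f' s x) (at x)"
    and bound: "\<And>s x. x \<in> ball z r \<Longrightarrow> norm (f' s x) \<le> B s"
    and B: "integrable M B"
    and meas: "(\<lambda>s. f' s z) \<in> borel_measurable M"
  shows "((\<lambda>x. integral\<^sup>L M (\<lambda>s. f s x)) has_field_derivative integral\<^sup>L M (\<lambda>s. f' s z)) (at z)"
  unfolding DERIV_def tendsto_at_iff_sequentially comp_def
proof (intro allI impI)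
  fix h :: "nat \<Rightarrow> 'a"
  assume h0: "\<forall>i. h i \<in> UNIV - {0}" and h: "h \<longlonglongrightarrow> 0"
  obtain N where N: "\<And>n. n \<ge> N \<Longrightarrow> norm (h n) < r"
    using LIMSEQ_D[OF h r] by auto
  \<comment> \<open>Dropping the first \<open>N\<close> terms keeps every \<open>z + k n\<close>
    inside the ball; \<open>LIMSEQ_offset\<close> undoes the shift at the end.\<close>
  define k where "k = (\<lambda>n. h (n + N))"
  have k: "k \<longlonglongrightarrow> 0" "\<And>n. k n \<noteq> 0" "\<And>n. norm (k n) < r"
    using h0 N LIMSEQ_ignore_initial_segment[OF h, of N] by (auto simp: k_def)
  have in_ball: "z + k n \<in> ball z r" "z \<in> ball z r" for n
    using k(3)[of n] r by (auto simp: dist_norm)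
  have "(\<lambda>n. integral\<^sup>L M (\<lambda>s. (f s (z + k n) - f s z) / k n)) \<longlonglongrightarrow> integral\<^sup>L M (\<lambda>s. f' s z)"
  proof (rule integral_dominated_convergence[where w = B])
    show "(\<lambda>s. (f s (z + k n) - f s z) / k n) \<in> borel_measurable M" for n
      using int[OF in_ball(1)[of n]] int[OF in_ball(2)]
      by (auto intro!: borel_measurable_integrable)
    show "AE s in M. (\<lambda>n. (f s (z + k n) - f s z) / k n) \<longlonglongrightarrow> f' s z"
      using deriv[OF in_ball(2)] k unfolding DERIV_def tendsto_at_iff_sequentially comp_def by auto
    have "norm (f s (z + k n) - f s z) \<le> B s * norm (z + k n - z)" for s n
      by (rule field_differentiable_bound[OF convex_ball[of z r]])
         (use bound deriv in_ball in \<open>auto intro: has_field_derivative_at_within\<close>)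
    then show "AE s in M. norm ((f s (z + k n) - f s z) / k n) \<le> B s" for n
      using k(2)[of n] by (auto simp: norm_divide divide_le_eq)
  qed (use B meas in auto)
  moreover have "integral\<^sup>L M (\<lambda>s. (f s (z + k n) - f s z) / k n)
      = (integral\<^sup>L M (\<lambda>s. f s (z + k n)) - integral\<^sup>L M (\<lambda>s. f s z)) / k n" for n
    using int[OF in_ball(1)[of n]] int[OF in_ball(2)] by simp
  ultimately have "(\<lambda>n. (integral\<^sup>L M (\<lambda>s. f s (z + h (n + N))) - integral\<^sup>L M (\<lambda>s. f s z)) / h (n + N))
      \<longlonglongrightarrow> integral\<^sup>L M (\<lambda>s. f' s z)"
    by (simp only: k_def)
  then show "(\<lambda>n. (integral\<^sup>L M (\<lambda>s. f s (z + h n)) - integral\<^sup>L M (\<lambda>s. f s z)) / h n)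
      \<longlonglongrightarrow> integral\<^sup>L M (\<lambda>s. f' s z)"
    by (rule LIMSEQ_offset)
qed

text \<open>After the substitution \<open>t = p + x v\<close> this is the Poisson integral at \<open>p + \<i> x\<close> for \<open>x > 0\<close>;
  in this form it extends continuously to \<open>x = 0\<close>.\<close>

definition poisson :: "(real \<Rightarrow> complex) \<Rightarrow> real \<times> real \<Rightarrow> complex" where
  "poisson f = (\<lambda>(x, p). (LINT v|lborel. of_real (1 / (1 + v\<^sup>2)) * f (p + x * v)) / of_real pi)"

lemma integrable_Cauchy_kernel_mult:
  fixes g :: "real \<Rightarrow> complex"
  assumes "g \<in> borel_measurable borel" and "\<And>v. norm (g v) \<le> B"
  shows "integrable lborel (\<lambda>v. of_real (1 / (1 + v\<^sup>2)) * g v)"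
proof (rule Bochner_Integration.integrable_bound)
  show "integrable lborel (\<lambda>t. B * (1 / (1 + t\<^sup>2)))"
    by (rule integrable_mult_right[OF integrable_Cauchy_kernel])
  show "AE v in lborel. norm (complex_of_real (1 / (1 + v\<^sup>2)) * g v) \<le> norm (B * (1 / (1 + v\<^sup>2)))"
    using assms(2) order_trans[OF norm_ge_zero assms(2)]
    by (auto simp: norm_mult norm_divide simp flip: of_real_power of_real_add intro!: divide_right_mono)
qed (use assms(1) in auto)

lemma poisson_0:
  shows "poisson f (0, p) = f p"
proof -
  have "(LINT v|lborel. complex_of_real (1 / (1 + v\<^sup>2)) * f p) = of_real pi * f p"
    by (subst integral_mult_left_zero, subst integral_complex_of_real, subst integral_Cauchy_kernel) auto
  then show ?thesis
    by (simp add: poisson_def)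
qed

text \<open>The majorant \<open>B / (1 + v^2)\<close> depends on neither coordinate, so dominated
  convergence gives joint continuity, also at boundary points \<open>x = 0\<close>, where the value
  is \<open>f p\<close>. The limits in the sufficiency proof rest on this.\<close>

lemma continuous_poisson:
  assumes cont: "continuous_on UNIV f" and bdd: "\<And>t. norm (f t) \<le> B"
  shows "isCont (poisson f) xp"
proof (rule continuous_at_sequentiallyI)
  fix u :: "nat \<Rightarrow> real \<times> real" assume u: "u \<longlonglongrightarrow> xp"
  have [measurable]: "f \<in> borel_measurable borel"
    using cont by (rule borel_measurable_continuous_onI)
  have "(\<lambda>n. LINT v|lborel. complex_of_real (1 / (1 + v\<^sup>2)) * f (snd (u n) + fst (u n) * v))
     \<longlonglongrightarrow> (LINT v|lborel. of_real (1 / (1 + v\<^sup>2)) * f (snd xp + fst xp * v))"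
  proof (rule integral_dominated_convergence[where w = "\<lambda>v. B * (1 / (1 + v\<^sup>2))"])
    have "(\<lambda>n. f (snd (u n) + fst (u n) * v)) \<longlonglongrightarrow> f (snd xp + fst xp * v)" for v
      by (rule continuous_on_tendsto_compose[OF cont]) (auto intro!: tendsto_intros u)
    then show "AE v in lborel. (\<lambda>n. complex_of_real (1 / (1 + v\<^sup>2)) * f (snd (u n) + fst (u n) * v))
         \<longlonglongrightarrow> complex_of_real (1 / (1 + v\<^sup>2)) * f (snd xp + fst xp * v)"
      by (intro AE_I2 tendsto_mult tendsto_const)
    show "AE v in lborel. norm (complex_of_real (1 / (1 + v\<^sup>2)) * f (snd (u n) + fst (u n) * v))
         \<le> B * (1 / (1 + v\<^sup>2))" for n
      using bdd by (auto simp: norm_mult norm_divide simp flip: of_real_power of_real_add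
          intro!: divide_right_mono)
    show "integrable lborel (\<lambda>v. B * (1 / (1 + v\<^sup>2)))"
      by (rule integrable_mult_right[OF integrable_Cauchy_kernel])
  qed auto
  then show "(\<lambda>n. poisson f (u n)) \<longlonglongrightarrow> poisson f xp"
    by (auto simp: poisson_def case_prod_beta intro!: tendsto_intros)
qed

text \<open>Serves to merge the masses on the two half-lines into one sequence. The proof treats
  real and imaginary parts separately.\<close>

lemma sums_interleave:
  fixes f g :: "nat \<Rightarrow> complex"
  assumes "g sums x" and "f sums y"
  shows "(\<lambda>n. if even n then f (n div 2) else g ((n - 1) div 2)) sums (x + y)"
proof -
  have "(\<lambda>n. Re (if even n then f (n div 2) else g ((n - 1) div 2)))
      = (\<lambda>n. if even n then Re (f (n div 2)) else Re (g ((n - 1) div 2)))"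
    "(\<lambda>n. Im (if even n then f (n div 2) else g ((n - 1) div 2)))
      = (\<lambda>n. if even n then Im (f (n div 2)) else Im (g ((n - 1) div 2)))"
    by auto
  then show ?thesis
    using assms by (simp only: sums_complex_iff plus_complex.sel) (auto intro!: sums_if)
qed

text \<open>The correction \<open>t / (t^2 + 1)\<close> cancels the \<open>1 / t\<close> tail of the
  Cauchy kernel. This form displays the resulting decay, with a second factor that is bounded in
  \<open>t\<close>.\<close>

lemma modified_cauchy_kernel_eq:
  assumes "Im z \<noteq> 0"
  shows "1 / (z - of_real t) + of_real (t / (t\<^sup>2 + 1))
    = of_real (1 / (1 + t\<^sup>2)) * ((1 + of_real t * z) / (z - of_real t))"
proof -
  have "z - of_real t \<noteq> 0" "complex_of_real (t\<^sup>2 + 1) \<noteq> 0"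
    using assms by (auto simp: complex_eq_iff add_nonneg_eq_0_iff simp del: of_real_add of_real_power)
  then show ?thesis
    by (simp add: field_simps power2_eq_square)
qed

text \<open>Division with remainder in \<open>t\<close>: the quotient equals
  \<open>(1 + z^2) / (z - t) - z\<close>, and \<open>d\<close> bounds the denominator from
  below.\<close>

lemma norm_Cauchy_factor_le:
  assumes "d > 0" "\<bar>Im z\<bar> \<ge> d"
  shows "norm ((1 + of_real t * z) / (z - of_real t)) \<le> norm (1 + z\<^sup>2) / d + norm z"
proof -
  have nz: "z - of_real t \<noteq> 0" and "norm (z - of_real t) \<ge> d"
    using assms abs_Im_le_cmod[of "z - of_real t"] by auto
  then have "norm ((1 + z\<^sup>2) / (z - of_real t)) \<le> norm (1 + z\<^sup>2) / d"
    using assms by (auto simp: norm_divide intro!: divide_left_mono mult_pos_pos)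
  moreover have "(1 + of_real t * z) / (z - of_real t) = (1 + z\<^sup>2) / (z - of_real t) - z"
    using nz by (simp add: field_simps power2_eq_square)
  ultimately show ?thesis
    using norm_triangle_ineq4[of "(1 + z\<^sup>2) / (z - of_real t)" z] by auto
qed

text \<open>Since \<open>1 + t^2\<close> is the squared modulus of \<open>t + \<i>\<close>, it
  suffices to bound \<open>(t + \<i>) / (z - t) = (z + \<i>) / (z - t) - 1\<close>. The result is a
  majorant integrable in \<open>t\<close> and locally uniform in \<open>z\<close>.\<close>

lemma norm_Cauchy_kernel_deriv_le:
  assumes "d > 0" "\<bar>Im z\<bar> \<ge> d"
  shows "norm (1 / (z - of_real t)\<^sup>2) \<le> (1 + (norm z + 1) / d)\<^sup>2 * (1 / (1 + t\<^sup>2))"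
proof -
  have nz: "z - of_real t \<noteq> 0" and le: "norm (z - of_real t) \<ge> d"
    using assms abs_Im_le_cmod[of "z - of_real t"] by auto
  have "norm ((of_real t + \<i>) / (z - of_real t)) = norm ((z + \<i>) / (z - of_real t) - 1)"
    using nz by (intro arg_cong[where f = norm]) (simp add: field_simps)
  also have "\<dots> \<le> norm ((z + \<i>) / (z - of_real t)) + 1"
    using norm_triangle_ineq4[of _ 1] by (metis norm_one)
  also have "norm ((z + \<i>) / (z - of_real t)) \<le> (norm z + 1) / d"
    using nz le assms norm_triangle_ineq[of z \<i>] unfolding norm_divide by (intro frac_le) auto
  finally have "(norm ((of_real t + \<i>) / (z - of_real t)))\<^sup>2 \<le> (1 + (norm z + 1) / d)\<^sup>2"
    by (intro power_mono) auto
  moreover have "(norm (of_real t + \<i>))\<^sup>2 = 1 + t\<^sup>2"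
    by (simp add: cmod_power2)
  ultimately have "(1 + t\<^sup>2) / (norm (z - of_real t))\<^sup>2 \<le> (1 + (norm z + 1) / d)\<^sup>2"
    by (simp add: norm_divide power_divide)
  then show ?thesis
    using nz by (simp add: norm_divide norm_power divide_simps add_pos_nonneg split: if_splits)
qed

section \<open>The modified Cauchy transform of a bounded continuous function: holomorphy and
  jump\<close>

locale bounded_continuous =
  fixes f :: "real \<Rightarrow> complex" and B :: real
  assumes cont: "continuous_on UNIV f" and bdd: "\<And>t. norm (f t) \<le> B"
begin

lemma measurable_f [measurable]: "f \<in> borel_measurable borel"
  using cont by (rule borel_measurable_continuous_onI)

lemma integrable_modified_cauchy:
  assumes "Im z \<noteq> 0"
  shows "integrable lborel (\<lambda>t. (1 / (z - of_real t) + of_real (t / (t\<^sup>2 + 1))) * f t)"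
  unfolding modified_cauchy_kernel_eq[OF assms] mult.assoc
proof (rule integrable_Cauchy_kernel_mult)
  fix v
  have "norm ((1 + of_real v * z) / (z - of_real v)) \<le> norm (1 + z\<^sup>2) / \<bar>Im z\<bar> + norm z"
    by (rule norm_Cauchy_factor_le) (use assms in auto)
  then show "norm ((1 + of_real v * z) / (z - of_real v) * f v)
      \<le> (norm (1 + z\<^sup>2) / \<bar>Im z\<bar> + norm z) * B"
    unfolding norm_mult by (intro mult_mono bdd) auto
qed measurable

lemma field_differentiable_modified_cauchy:
  assumes "Im z \<noteq> 0"
  shows "modified_cauchy f field_differentiable (at z)"
proof -
  \<comment> \<open>With half the distance to the real axis as radius, the whole ball stays at
    distance at least \<open>d\<close> from the axis, so one majorant works for all its
    points.\<close>
  define d where "d = \<bar>Im z\<bar> / 2"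
  have d: "d > 0" using assms by (simp add: d_def)
  have ball: "\<bar>Im w\<bar> \<ge> d" "norm w \<le> norm z + d" if "w \<in> ball z d" for w
  proof -
    show "\<bar>Im w\<bar> \<ge> d"
      using that abs_Im_le_cmod[of "z - w"] by (auto simp: dist_norm d_def)
    show "norm w \<le> norm z + d"
      using that norm_triangle_ineq2[of w z] by (auto simp: dist_norm norm_minus_commute)
  qed
  have "((\<lambda>w. LINT t|lborel. (1 / (w - of_real t) + of_real (t / (t\<^sup>2 + 1))) * f t) has_field_derivative
      (LINT t|lborel. - (1 / (z - of_real t)\<^sup>2) * f t)) (at z)"
  proof (rule has_field_derivative_integral[OF d,
        where B = "\<lambda>t. (1 + (norm z + d + 1) / d)\<^sup>2 * (1 / (1 + t\<^sup>2)) * B"])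
    fix w assume w: "w \<in> ball z d"
    note w' = ball[OF w]
    show "integrable lborel (\<lambda>t. (1 / (w - of_real t) + of_real (t / (t\<^sup>2 + 1))) * f t)"
      using w' d by (intro integrable_modified_cauchy) auto
    fix t
    have nz: "w - of_real t \<noteq> 0"
      using w' d by (auto simp: complex_eq_iff)
    show "((\<lambda>w. (1 / (w - of_real t) + of_real (t / (t\<^sup>2 + 1))) * f t) has_field_derivative
      - (1 / (w - of_real t)\<^sup>2) * f t) (at w)"
      using nz by (auto intro!: derivative_eq_intros simp: power2_eq_square)
    have "norm (1 / (w - of_real t)\<^sup>2) \<le> (1 + (norm w + 1) / d)\<^sup>2 * (1 / (1 + t\<^sup>2))"
      by (rule norm_Cauchy_kernel_deriv_le) (use w' d in auto)
    also have "\<dots> \<le> (1 + (norm z + d + 1) / d)\<^sup>2 * (1 / (1 + t\<^sup>2))"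
      using w' d by (intro mult_right_mono power_mono add_left_mono divide_right_mono) auto
    finally show "norm (- (1 / (w - of_real t)\<^sup>2) * f t)
        \<le> (1 + (norm z + d + 1) / d)\<^sup>2 * (1 / (1 + t\<^sup>2)) * B"
      unfolding norm_mult norm_minus_cancel by (intro mult_mono bdd) auto
  next
    show "integrable lborel (\<lambda>t. (1 + (norm z + d + 1) / d)\<^sup>2 * (1 / (1 + t\<^sup>2)) * B)"
      by (intro integrable_mult_left integrable_mult_right integrable_Cauchy_kernel)
  qed measurable
  then have "(\<lambda>w. LINT t|lborel. (1 / (w - of_real t) + of_real (t / (t\<^sup>2 + 1))) * f t)
      field_differentiable (at z)"
    unfolding field_differentiable_def by blast
  then show ?thesis
    unfolding modified_cauchy_def[abs_def] by (intro field_differentiable_mult) auto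
qed

lemma holomorphic_modified_cauchy: "modified_cauchy f holomorphic_on {z. Im z \<noteq> 0}"
  unfolding holomorphic_on_def
  using field_differentiable_modified_cauchy field_differentiable_at_within by blast

text \<open>The corrections \<open>t / (t^2 + 1)\<close> cancel. After \<open>t = p + x v\<close>,
  with Jacobian \<open>x\<close>, the remaining difference of kernels is
  \<open>- 2 \<i> / (1 + v^2)\<close>, and the prefactor \<open>\<i> / pi\<close> turns this into
  \<open>2 / pi\<close> times the Cauchy kernel.\<close>

lemma modified_cauchy_jump:
  assumes "x > 0"
  shows "modified_cauchy f (Complex p x) - modified_cauchy f (Complex p (- x)) = 2 * poisson f (x, p)"
proof -
  let ?k = "\<lambda>z t. 1 / (z - complex_of_real t) + of_real (t / (t\<^sup>2 + 1))"
  have *: "of_real x * (?k (Complex p x) (p + x * v) - ?k (Complex p (-x)) (p + x * v))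
      = - 2 * \<i> * of_real (1 / (1 + v\<^sup>2))" for v
  proof -
    have eq: "Complex p x - of_real (p + x * v) = of_real x * (\<i> - of_real v)"
      "Complex p (-x) - of_real (p + x * v) = of_real x * (- \<i> - of_real v)"
      by (auto simp: complex_eq_iff algebra_simps)
    have "\<i> - of_real v \<noteq> 0" "- \<i> - of_real v \<noteq> 0" "complex_of_real (1 + v\<^sup>2) \<noteq> 0"
      by (auto simp: complex_eq_iff add_nonneg_eq_0_iff simp del: of_real_add of_real_power)
    then have "1 / (\<i> - of_real v) - 1 / (- \<i> - of_real v) = - 2 * \<i> * of_real (1 / (1 + v\<^sup>2))"
      by (simp add: field_simps power2_eq_square)
    moreover have "of_real x * (?k (Complex p x) (p + x * v) - ?k (Complex p (-x)) (p + x * v))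
        = 1 / (\<i> - of_real v) - 1 / (- \<i> - of_real v)"
    proof -
      have "of_real x * (1 / (of_real x * a) + c - (1 / (of_real x * b) + c)) = 1 / a - 1 / b" for a b c :: complex
        using assms by (simp add: field_simps)
      then show ?thesis unfolding eq .
    qed
    ultimately show ?thesis by simp
  qed
  have int: "integrable lborel (\<lambda>t. ?k (Complex p y) t * f t)" if "y \<noteq> 0" for y
    by (rule integrable_modified_cauchy) (use that in simp)
  have "modified_cauchy f (Complex p x) - modified_cauchy f (Complex p (- x))
      = \<i> / of_real pi * (LINT t|lborel. (?k (Complex p x) t - ?k (Complex p (-x)) t) * f t)"
    unfolding modified_cauchy_def right_diff_distrib[symmetric] left_diff_distrib
    using assms by (simp only: Bochner_Integration.integral_diff[OF int int] neg_equal_0_iff_equal)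
  also have "(LINT t|lborel. (?k (Complex p x) t - ?k (Complex p (-x)) t) * f t)
      = x *\<^sub>R (LINT v|lborel. (?k (Complex p x) (p + x * v) - ?k (Complex p (-x)) (p + x * v)) * f (p + x * v))"
    using lborel_integral_real_affine[of x "\<lambda>t. (?k (Complex p x) t - ?k (Complex p (-x)) t) * f t" p] assms
    by simp
  also have "\<dots> = (LINT v|lborel. of_real x * (?k (Complex p x) (p + x * v) - ?k (Complex p (-x)) (p + x * v)) * f (p + x * v))"
    by (simp only: scaleR_conv_of_real integral_mult_right_zero[symmetric] mult.assoc)
  also have "\<dots> = (LINT v|lborel. - 2 * \<i> * (of_real (1 / (1 + v\<^sup>2)) * f (p + x * v)))"
    unfolding * by (simp only: mult.assoc)
  also have "\<dots> = - 2 * \<i> * (LINT v|lborel. of_real (1 / (1 + v\<^sup>2)) * f (p + x * v))"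
    by (rule integral_mult_right_zero)
  finally show ?thesis
    by (simp add: poisson_def complex_eq_iff)
qed

end

section \<open>Power series with nonnegative coefficients\<close>

text \<open>The disc of radius \<open>N\<close> about \<open>N\<close> lies in the right half-plane,
  so the Taylor series at \<open>N\<close> converges there. With \<open>w = N (1 - u)\<close> the
  powers \<open>(w - N) ^ k = (- N) ^ k * u ^ k\<close> supply exactly the signs that complete
  monotonicity asks for.\<close>

lemma completely_monotonic_power_series:
  assumes hol: "F holomorphic_on {w. Re w > 0}"
    and real: "\<And>y. y > 0 \<Longrightarrow> F (of_real y) = of_real (\<omega> y)"
    and cm: "completely_monotonic_on \<omega> {0<..}"
    and N: "N > 0"
  obtains c :: "nat \<Rightarrow> real"
    where "\<And>k. c k \<ge> 0"
      and "\<And>u. norm u < 1 \<Longrightarrow> (\<lambda>k. of_real (c k) * u ^ k) sums F (of_real N * (1 - u))"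
proof -
  let ?H = "{w. Re w > 0}"
  obtain D where D0: "\<And>x. x > 0 \<Longrightarrow> D 0 x = \<omega> x"
    and D: "\<And>n x. x > 0 \<Longrightarrow> (D n has_real_derivative D (Suc n) x) (at x)"
    and sgn: "\<And>n x. x > 0 \<Longrightarrow> (-1) ^ n * D n x \<ge> 0"
    using cm unfolding completely_monotonic_on_def Ball_def greaterThan_iff by blast
  have op: "open ?H" by (rule open_halfspace_Re_gt)
  \<comment> \<open>Links the complex derivatives to the real witnesses \<open>D\<close>: along the
    real axis both are vector derivatives of the same function, hence equal by uniqueness.\<close>
  have higher: "(deriv ^^ n) F (of_real x) = of_real (D n x)" if "x > 0" for n x
    using that
  proof (induction n arbitrary: x)
    case 0
    then show ?case by (simp add: real D0)
  next
    case (Suc n)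
    have "(deriv ^^ n) F holomorphic_on ?H"
      by (rule holomorphic_higher_deriv[OF hol op])
    then have "((deriv ^^ n) F has_field_derivative deriv ((deriv ^^ n) F) (of_real x)) (at (of_real x))"
      using Suc.prems op by (auto intro: holomorphic_derivI)
    then have "((\<lambda>t. (deriv ^^ n) F (of_real t)) has_vector_derivative
        deriv ((deriv ^^ n) F) (of_real x)) (at x)"
      by (rule has_vector_derivative_real_field)
    moreover have "((\<lambda>t. (deriv ^^ n) F (of_real t)) has_vector_derivative of_real (D (Suc n) x)) (at x)"
    proof (rule has_vector_derivative_transform_within_open)
      show "((\<lambda>t. complex_of_real (D n t)) has_vector_derivative of_real (D (Suc n) x)) (at x)"
        using D[OF Suc.prems, of n]
        by (intro has_vector_derivative_of_real) (simp add: has_real_derivative_iff_has_vector_derivative)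
      show "open {0::real<..}" "x \<in> {0<..}" using Suc.prems by auto
    qed (use Suc.IH in auto)
    ultimately have "deriv ((deriv ^^ n) F) (of_real x) = of_real (D (Suc n) x)"
      by (rule vector_derivative_unique_at)
    then show ?case by simp
  qed
  define c where "c k = (-1) ^ k * D k N * N ^ k / fact k" for k
  show thesis
  proof
    show "c k \<ge> 0" for k
      using sgn[OF N, of k] N by (auto simp: c_def intro!: divide_nonneg_pos mult_nonneg_nonneg)
    fix u :: complex assume u: "norm u < 1"
    have "ball (of_real N) N \<subseteq> ?H"
    proof
      fix w assume "w \<in> ball (complex_of_real N) N"
      then show "w \<in> ?H"
        using complex_Re_le_cmod[of "of_real N - w"] by (auto simp: dist_norm)
    qed
    then have "F holomorphic_on ball (of_real N) N"
      using hol holomorphic_on_subset by blast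
    moreover have "of_real N * (1 - u) \<in> ball (of_real N) N"
      using u N by (simp add: dist_norm norm_mult right_diff_distrib)
    ultimately have "(\<lambda>k. (deriv ^^ k) F (of_real N) / fact k * (of_real N * (1 - u) - of_real N) ^ k)
        sums F (of_real N * (1 - u))"
      by (rule holomorphic_power_series)
    moreover have "(deriv ^^ k) F (of_real N) / fact k * (of_real N * (1 - u) - of_real N) ^ k
        = of_real (c k) * u ^ k" for k
    proof -
      have "of_real N * (1 - u) - of_real N = (-1) * of_real N * u"
        by (simp add: algebra_simps)
      then show ?thesis
        by (simp only: power_mult_distrib) (simp add: higher[OF N] c_def)
    qed
    ultimately show "(\<lambda>k. of_real (c k) * u ^ k) sums F (of_real N * (1 - u))"
      by simp
  qed
qed

text \<open>Abel's theorem needs summability on the boundary; for nonnegative coefficients this comes for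
  free from boundedness.\<close>

lemma nonneg_power_series_summable:
  fixes c :: "nat \<Rightarrow> real"
  assumes nonneg: "\<And>k. c k \<ge> 0"
    and sums: "\<And>r. 0 \<le> r \<Longrightarrow> r < 1 \<Longrightarrow> (\<lambda>k. c k * r ^ k) sums g r"
    and bound: "\<And>r. 0 \<le> r \<Longrightarrow> r < 1 \<Longrightarrow> g r \<le> C"
  shows "summable c"
proof (rule bounded_imp_summable)
  fix n
  have "((\<lambda>r. \<Sum>k\<le>n. c k * r ^ k) \<longlongrightarrow> (\<Sum>k\<le>n. c k * 1 ^ k)) (at_left 1)"
    by (intro tendsto_intros)
  moreover have "\<forall>\<^sub>F r in at_left (1::real). (\<Sum>k\<le>n. c k * r ^ k) \<le> C"
  proof -
    have "(\<Sum>k\<le>n. c k * r ^ k) \<le> C" if "0 < r" "r < 1" for r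
    proof -
      have "(\<Sum>k\<le>n. c k * r ^ k) \<le> g r"
        unfolding sums_unique[OF sums[of r, OF less_imp_le[OF that(1)] that(2)]]
        by (intro sum_le_suminf) (use sums[of r] nonneg that in \<open>auto simp: sums_iff\<close>)
      then show ?thesis using bound[of r] that by auto
    qed
    then show ?thesis
      unfolding eventually_at_left_field by (intro exI[of _ 0]) auto
  qed
  ultimately have "(\<Sum>k\<le>n. c k * 1 ^ k) \<le> C"
    by (rule tendsto_upperbound) auto
  then show "(\<Sum>k\<le>n. c k) \<le> C" by simp
qed (use nonneg in auto)

text \<open>Summability of \<open>c\<close> makes the Weierstrass M-test work on the closed disc, so
  the sum is continuous up to the unit circle and its radial limits are the boundary series.\<close>

lemma power_series_boundary:
  fixes c :: "nat \<Rightarrow> real" and u :: complex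
  assumes "summable c" and "\<And>k. c k \<ge> 0" and u: "norm u = 1"
    and sums: "\<And>u. norm u < 1 \<Longrightarrow> (\<lambda>k. of_real (c k) * u ^ k) sums G u"
  shows "((\<lambda>r. G (of_real r * u)) \<longlongrightarrow> (\<Sum>k. of_real (c k) * u ^ k)) (at_left 1)"
    and "summable (\<lambda>k. of_real (c k) * u ^ k)"
proof -
  have bd: "norm (of_real (c k) * w ^ k) \<le> c k" if "norm w \<le> 1" for w :: complex and k
    using that assms(2)[of k] by (auto simp: norm_mult norm_power intro!: mult_left_le power_le_one)
  have ev: "\<forall>\<^sub>F r in at_left (1::real). 0 < r \<and> r < 1"
    unfolding eventually_at_left_field by (intro exI[of _ 0]) auto
  have "uniform_limit (cball 0 1) (\<lambda>n w. \<Sum>k<n. of_real (c k) * w ^ k)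
      (\<lambda>w::complex. \<Sum>k. of_real (c k) * w ^ k) sequentially"
    using bd assms(1) by (intro Weierstrass_m_test) auto
  then have "continuous_on (cball 0 1) (\<lambda>w::complex. \<Sum>k. of_real (c k) * w ^ k)"
    by (rule uniform_limit_theorem[rotated]) (auto intro!: always_eventually continuous_intros)
  moreover have "((\<lambda>r. of_real r * u) \<longlongrightarrow> of_real 1 * u) (at_left 1)"
    by (intro tendsto_intros)
  moreover have "\<forall>\<^sub>F r in at_left (1::real). of_real r * u \<in> cball 0 1"
    using ev by eventually_elim (use u in \<open>auto simp: norm_mult\<close>)
  ultimately have "((\<lambda>r. \<Sum>k. of_real (c k) * (of_real r * u) ^ k) \<longlongrightarrow>
      (\<Sum>k. of_real (c k) * (of_real 1 * u) ^ k)) (at_left (1::real))"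
    using u by (intro continuous_on_tendsto_compose[where f = "\<lambda>w. \<Sum>k. of_real (c k) * w ^ k"]) auto
  moreover have "\<forall>\<^sub>F r in at_left 1. (\<Sum>k. of_real (c k) * (of_real r * u) ^ k) = G (of_real r * u)"
    using ev by eventually_elim (use u in \<open>auto intro!: sums_unique[symmetric] sums simp: norm_mult\<close>)
  ultimately show "((\<lambda>r. G (of_real r * u)) \<longlongrightarrow> (\<Sum>k. of_real (c k) * u ^ k)) (at_left 1)"
    by (simp only: of_real_1 mult_1_left) (rule Lim_transform_eventually)
  show "summable (\<lambda>k. of_real (c k) * u ^ k)"
    using bd u assms(1) by (intro summable_comparison_test'[OF assms(1)]) auto
qed

section \<open>Discrete probability measures on the line\<close>

definition discrete_distr :: "(nat \<Rightarrow> real) \<Rightarrow> (nat \<Rightarrow> real) \<Rightarrow> real measure" where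
  "discrete_distr e x = distr (density (count_space UNIV) (\<lambda>j. ennreal (e j))) borel x"

lemma real_distribution_discrete_distr:
  assumes "\<And>j. e j \<ge> 0" "e sums 1"
  shows "real_distribution (discrete_distr e x)"
proof -
  have "(\<integral>\<^sup>+ j. ennreal (e j) \<partial>count_space UNIV) = 1"
    unfolding nn_integral_count_space_nat
    by (subst suminf_ennreal2) (use assms in \<open>simp_all add: sums_iff\<close>)
  then have "prob_space (density (count_space UNIV) (\<lambda>j. ennreal (e j)))"
    by (intro prob_spaceI) (simp add: emeasure_density)
  then have "prob_space (discrete_distr e x)"
    unfolding discrete_distr_def by (rule prob_space.prob_space_distr) auto
  then show ?thesis
    by (intro real_distribution.intro real_distribution_axioms.intro) (auto simp: discrete_distr_def)
qed

lemma integral_discrete_distr: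
  fixes g :: "real \<Rightarrow> complex"
  assumes e: "\<And>j. e j \<ge> 0" and "g \<in> borel_measurable borel"
    and sums: "(\<lambda>j. of_real (e j) * g (x j)) sums S" and summable: "summable e" and "\<And>t. norm (g t) \<le> C"
  shows "integral\<^sup>L (discrete_distr e x) g = S"
proof -
  have "summable (\<lambda>j. norm (e j *\<^sub>R g (x j)))"
    by (rule summable_comparison_test'[where g = "\<lambda>j. C * e j", OF summable_mult[OF summable]])
       (use assms in \<open>auto simp: mult.commute[of C] intro: mult_left_mono\<close>)
  then have "integral\<^sup>L (count_space UNIV) (\<lambda>j. e j *\<^sub>R g (x j)) = S"
    using sums by (subst integral_count_space_nat)
      (auto simp: integrable_count_space_nat_iff scaleR_conv_of_real sums_iff)
  then show ?thesis
    unfolding discrete_distr_def using assms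
    by (subst integral_distr) (auto simp: integral_density)
qed

section \<open>Sufficiency\<close>

context bounded_continuous
begin

lemma norm_poisson_le: "norm (poisson f xp) \<le> B"
proof (cases xp)
  case (Pair x p)
  have "norm (LINT v|lborel. complex_of_real (1 / (1 + v\<^sup>2)) * f (p + x * v))
      \<le> (LINT v|lborel. B * (1 / (1 + v\<^sup>2)))"
  proof (rule order_trans[OF integral_norm_bound integral_mono'])
    show "integrable lborel (\<lambda>v. B * (1 / (1 + v\<^sup>2)))"
      by (rule integrable_mult_right[OF integrable_Cauchy_kernel])
    show "norm (complex_of_real (1 / (1 + v\<^sup>2)) * f (p + x * v)) \<le> B * (1 / (1 + v\<^sup>2))" for v
      using bdd by (auto simp: norm_mult norm_divide simp flip: of_real_power of_real_add
          intro!: divide_right_mono)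
    then show "0 \<le> B * (1 / (1 + v\<^sup>2))" for v
      using norm_ge_zero order_trans by blast
  qed
  also have "\<dots> = B * pi"
    by (subst integral_mult_right_zero, subst integral_Cauchy_kernel) simp
  finally show ?thesis
    by (simp add: Pair poisson_def norm_divide divide_le_eq)
qed

text \<open>For \<open>u\<close> on the unit circle the points \<open>N (1 - u)\<close> and
  \<open>N (1 - cnj u)\<close> are conjugate, so the two power series add up to a jump of the
  transform, that is, to a Poisson integral. Taking \<open>u = cis (s / N)\<close> yields the
  characteristic function, and real \<open>u = exp (- l / N)\<close> the Laplace transform.\<close>

lemma discretization:
  assumes f0: "f 0 = 1"
    and Im_pos: "\<And>y. y > 0 \<Longrightarrow> Im (of_real a + modified_cauchy f (\<i> * of_real y)) = 0"
    and cm_pos: "completely_monotonic_on (\<lambda>y. Re (of_real a + modified_cauchy f (\<i> * of_real y))) {0<..}"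
    and Im_neg: "\<And>y. y < 0 \<Longrightarrow> Im (of_real a + modified_cauchy f (\<i> * of_real y)) = 0"
    and am_neg: "absolutely_monotonic_on (\<lambda>y. - Re (of_real a + modified_cauchy f (\<i> * of_real y))) {..<0}"
    and N: "N > 0"
  obtains \<sigma> where "real_distribution \<sigma>"
    and "\<And>s. char \<sigma> s = poisson f (N * (1 - cos (s / N)), N * sin (s / N))"
    and "\<And>l. l > 0 \<Longrightarrow> (LINT x|\<sigma>. complex_of_real (exp (- l * \<bar>x\<bar>))) = poisson f (N * (1 - exp (- l / N)), 0)"
proof -
  define F where "F w = of_real a + modified_cauchy f (\<i> * w)" for w
  define G where "G w = - (of_real a + modified_cauchy f (- (\<i> * w)))" for w
  \<comment> \<open>The points \<open>\<i> * w\<close> and \<open>- (\<i> * cnj w)\<close> are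
    mirror images in the real axis, so the jump relation applies; the constant \<open>a\<close>
    cancels.\<close>
  have FG: "F w + G (cnj w) = 2 * poisson f (Re w, - Im w)" if "Re w > 0" for w
  proof -
    have "\<i> * w = Complex (- Im w) (Re w)" "- (\<i> * cnj w) = Complex (- Im w) (- Re w)"
      by (simp_all add: complex_eq_iff)
    then show ?thesis
      using modified_cauchy_jump[OF that, of "- Im w"] by (simp add: F_def G_def)
  qed
  have hol: "(\<lambda>w. modified_cauchy f (c * w)) holomorphic_on {w. Re w > 0}" if "c = \<i> \<or> c = - \<i>" for c
  proof -
    have "(modified_cauchy f \<circ> (\<lambda>w. c * w)) holomorphic_on {w. Re w > 0}"
      by (intro holomorphic_on_compose_gen[OF _ holomorphic_modified_cauchy] holomorphic_intros)
         (use that in auto)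
    then show ?thesis by (simp add: o_def)
  qed
  have holF: "F holomorphic_on {w. Re w > 0}"
    unfolding F_def[abs_def] by (intro holomorphic_intros hol) auto
  have holG: "G holomorphic_on {w. Re w > 0}"
    unfolding G_def[abs_def] using hol[of "- \<i>"] by (intro holomorphic_intros) auto
  obtain c where c: "\<And>k. c k \<ge> 0"
    and c_sums: "\<And>u. norm u < 1 \<Longrightarrow> (\<lambda>k. of_real (c k) * u ^ k) sums F (of_real N * (1 - u))"
    by (rule completely_monotonic_power_series[OF holF _ cm_pos N]) (use Im_pos in \<open>auto simp: complex_eq_iff F_def\<close>)
  have refl: "uminus ` {..<0} = {0::real<..}"
    by auto
  obtain d where d: "\<And>k. d k \<ge> 0"
    and d_sums: "\<And>u. norm u < 1 \<Longrightarrow> (\<lambda>k. of_real (d k) * u ^ k) sums G (of_real N * (1 - u))"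
    by (rule completely_monotonic_power_series[OF holG _ am_neg[unfolded absolutely_monotonic_on_def refl] N])
       (use Im_neg[of "- _"] in \<open>auto simp: complex_eq_iff G_def\<close>)
  have FG_real: "F (of_real N * (1 - of_real r)) + G (of_real N * (1 - of_real r)) = 2 * poisson f (N * (1 - r), 0)"
    if "r < 1" for r
    using FG[of "of_real (N * (1 - r))"] that N by simp
  \<comment> \<open>The series are added first because \<open>F + G\<close> is twice a Poisson
    integral on the real axis and thus bounded by \<open>2 * B\<close>. Nonnegativity then gives
    summability of \<open>c\<close> and \<open>d\<close> separately.\<close>
  have "summable (\<lambda>k. c k + d k)"
  proof (rule nonneg_power_series_summable)
    show "c k + d k \<ge> 0" for k using c d by (simp add: add_nonneg_nonneg)
    fix r :: real assume r: "0 \<le> r" "r < 1"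
    have "(\<lambda>k. of_real (c k) * of_real r ^ k + of_real (d k) * of_real r ^ k) sums (2 * poisson f (N * (1 - r), 0))"
      unfolding FG_real[OF r(2), symmetric] by (intro sums_add c_sums d_sums) (use r in auto)
    then have "(\<lambda>k. Re (of_real (c k) * of_real r ^ k + of_real (d k) * of_real r ^ k))
        sums Re (2 * poisson f (N * (1 - r), 0))"
      by (rule sums_Re)
    then show "(\<lambda>k. (c k + d k) * r ^ k) sums Re (2 * poisson f (N * (1 - r), 0))"
      by (simp add: algebra_simps flip: of_real_power)
    show "Re (2 * poisson f (N * (1 - r), 0)) \<le> 2 * B"
      using norm_poisson_le[of "(N * (1 - r), 0)"] complex_Re_le_cmod[of "poisson f (N * (1 - r), 0)"]
      by simp
  qed
  then have sum_c: "summable c" and sum_d: "summable d"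
    using c d by (auto intro: summable_comparison_test'[where g = "\<lambda>k. c k + d k"])
  \<comment> \<open>Even indices carry the points \<open>k / N\<close>, odd ones the points
    \<open>- k / N\<close>. The origin occurs twice, for \<open>j = 0\<close> and
    \<open>j = 1\<close>, and its two masses add up in the image measure. Halving offsets the factor
    2 in the jump relation.\<close>
  define e where "e j = (if even j then c (j div 2) / 2 else d ((j - 1) div 2) / 2)" for j
  define x where "x j = (if even j then real (j div 2) / N else - real ((j - 1) div 2) / N)" for j
  have e: "e j \<ge> 0" for j using c d by (simp add: e_def)
  have interleave: "(\<lambda>j. of_real (e j) * g (x j)) sums ((S + T) / 2)"
    if "(\<lambda>k. of_real (c k) * g (real k / N)) sums S" "(\<lambda>k. of_real (d k) * g (- real k / N)) sums T"
    for g :: "real \<Rightarrow> complex" and S T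
  proof -
    have "(\<lambda>j. if even j then of_real (c (j div 2)) * g (real (j div 2) / N) / 2
        else of_real (d ((j - 1) div 2)) * g (- real ((j - 1) div 2) / N) / 2) sums (T / 2 + S / 2)"
      using sums_interleave[OF sums_divide[OF that(2), of 2] sums_divide[OF that(1), of 2]] .
    moreover have "(\<lambda>j. if even j then of_real (c (j div 2)) * g (real (j div 2) / N) / 2
        else of_real (d ((j - 1) div 2)) * g (- real ((j - 1) div 2) / N) / 2) = (\<lambda>j. of_real (e j) * g (x j))"
      by (auto simp: e_def x_def)
    ultimately show ?thesis by (simp add: add_divide_distrib add.commute)
  qed
  have char_sums: "(\<lambda>j. of_real (e j) * iexp (s * x j)) sums poisson f (N * (1 - cos (s / N)), N * sin (s / N))" for s
  proof -
    define u where "u = cis (s / N)"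
    have u: "norm u = 1" "norm (cnj u) = 1" by (simp_all add: u_def)
    note Fu = power_series_boundary[OF sum_c c u(1) c_sums] and Gu = power_series_boundary[OF sum_d d u(2) d_sums]
    \<comment> \<open>For \<open>r < 1\<close> both series represent \<open>F\<close> and
      \<open>G\<close>, and \<open>FG\<close> applies. Continuity of the Poisson integral then
      allows \<open>r\<close> to tend to 1, even for \<open>u = 1\<close>, where
      \<open>N (1 - u)\<close> reaches the boundary of the half-plane.\<close>
    have "\<forall>\<^sub>F r in at_left (1::real). 0 < r \<and> r < 1"
      unfolding eventually_at_left_field by (intro exI[of _ 0]) auto
    then have "\<forall>\<^sub>F r in at_left (1::real). F (of_real N * (1 - of_real r * u)) + G (of_real N * (1 - of_real r * cnj u))
        = 2 * poisson f (N * (1 - r * cos (s / N)), N * (r * sin (s / N)))"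
    proof eventually_elim
      case (elim r)
      have "r * cos (s / N) \<le> r * 1"
        using elim by (intro mult_left_mono) auto
      then have "r * cos (s / N) < 1"
        using elim by linarith
      then have "Re (of_real N * (1 - of_real r * u)) > 0"
        using N by (simp add: u_def)
      from FG[OF this] show ?case by (simp add: u_def)
    qed
    moreover have "((\<lambda>r. 2 * poisson f (N * (1 - r * cos (s / N)), N * (r * sin (s / N)))) \<longlongrightarrow>
        2 * poisson f (N * (1 - 1 * cos (s / N)), N * (1 * sin (s / N)))) (at_left 1)"
      by (intro tendsto_mult tendsto_const isCont_tendsto_compose[OF continuous_poisson[OF cont bdd]]
           tendsto_Pair tendsto_diff tendsto_ident_at)
    ultimately have "((\<lambda>r. F (of_real N * (1 - of_real r * u)) + G (of_real N * (1 - of_real r * cnj u))) \<longlongrightarrow>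
        2 * poisson f (N * (1 - 1 * cos (s / N)), N * (1 * sin (s / N)))) (at_left 1)"
      by (subst tendsto_cong)
    from tendsto_unique[OF _ tendsto_add[OF Fu(1) Gu(1)] this]
    have eq: "(\<Sum>k. of_real (c k) * u ^ k) + (\<Sum>k. of_real (d k) * cnj u ^ k)
        = 2 * poisson f (N * (1 - cos (s / N)), N * sin (s / N))"
      by simp
    have "iexp (s * (real k / N)) = u ^ k" "iexp (s * (- real k / N)) = cnj u ^ k" for k :: nat
      by (simp_all add: u_def DeMoivre cis_conv_exp exp_cnj flip: exp_of_nat_mult complex_cnj_power)
         (simp_all add: field_simps)
    then have "(\<lambda>j. of_real (e j) * iexp (s * x j)) sums
        (((\<Sum>k. of_real (c k) * u ^ k) + (\<Sum>k. of_real (d k) * cnj u ^ k)) / 2)"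
      using Fu(2) Gu(2) by (intro interleave) (simp_all add: summable_sums)
    then show ?thesis unfolding eq by simp
  qed
  \<comment> \<open>The total mass is the value at \<open>s = 0\<close>, namely
    \<open>poisson f (0, 0) = f 0 = 1\<close>.\<close>
  have "(\<lambda>j. complex_of_real (e j)) sums of_real 1"
    using char_sums[of 0] by (simp add: poisson_0 f0)
  then have e1: "e sums 1"
    unfolding sums_of_real_iff .
  show thesis
  proof
    show "real_distribution (discrete_distr e x)"
      by (rule real_distribution_discrete_distr) (use e e1 in auto)
    show "char (discrete_distr e x) s = poisson f (N * (1 - cos (s / N)), N * sin (s / N))" for s
      unfolding char_def
      by (rule integral_discrete_distr[where C = 1 and g = "\<lambda>t. iexp (s * t)"])
         (use e char_sums sums_summable[OF e1] in simp_all)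
    fix l :: real assume l: "l > 0"
    define r where "r = exp (- l / N)"
    have r: "0 < r" "r < 1" using l N by (auto simp: r_def)
    have "exp (- l * \<bar>real k / N\<bar>) = r ^ k" "exp (- l * \<bar>- real k / N\<bar>) = r ^ k" for k :: nat
      using N by (simp_all add: r_def field_simps flip: exp_of_nat_mult)
    then have "(\<lambda>j. of_real (e j) * of_real (exp (- l * \<bar>x j\<bar>))) sums
        ((F (of_real N * (1 - of_real r)) + G (of_real N * (1 - of_real r))) / 2)"
      using c_sums[of "of_real r"] d_sums[of "of_real r"] r
      by (intro interleave[where g = "\<lambda>t. of_real (exp (- l * \<bar>t\<bar>))"]) simp_all
    then have "(\<lambda>j. of_real (e j) * of_real (exp (- l * \<bar>x j\<bar>))) sums poisson f (N * (1 - r), 0)"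
      unfolding FG_real[OF r(2)] by simp
    then show "(LINT t|discrete_distr e x. complex_of_real (exp (- l * \<bar>t\<bar>))) = poisson f (N * (1 - exp (- l / N)), 0)"
      unfolding r_def
      by (intro integral_discrete_distr[where C = 1 and g = "\<lambda>t. of_real (exp (- l * \<bar>t\<bar>))"])
         (use e sums_summable[OF e1] l in simp_all)
  qed
qed

text \<open>The Laplace transforms are close to 1 for small \<open>l\<close>, uniformly in
  \<open>n\<close>, because their arguments are at most \<open>l\<close> and the Poisson integral is
  continuous at the origin. This prevents mass from escaping, and a weak limit along a subsequence
  has characteristic function \<open>f\<close>.\<close>

lemma characteristic_if_limit:
  assumes f0: "f 0 = 1"
    and \<sigma>: "\<And>n. real_distribution (\<sigma> n)"
    and char: "\<And>n s. char (\<sigma> n) s = poisson f (real (Suc n) * (1 - cos (s / real (Suc n))), real (Suc n) * sin (s / real (Suc n)))"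
    and laplace: "\<And>n l. l > 0 \<Longrightarrow> (LINT x|\<sigma> n. complex_of_real (exp (- l * \<bar>x\<bar>)))
      = poisson f (real (Suc n) * (1 - exp (- l / real (Suc n))), 0)"
  shows "is_characteristic_function f"
proof -
  have "tight \<sigma>"
    unfolding tight_def
  proof (intro conjI allI impI \<sigma>)
    fix \<epsilon> :: real assume \<epsilon>: "\<epsilon> > 0"
    \<comment> \<open>A Markov-type estimate is prepared here: for
      \<open>\<bar>x\<bar> \<ge> R\<close> the function \<open>1 - exp (- \<bar>x\<bar> / R)\<close>
      is at least \<open>1 - exp (- 1)\<close>.\<close>
    have "\<epsilon> * (1 - exp (- 1)) > 0" using \<epsilon> by simp
    then obtain \<delta> where \<delta>: "\<delta> > 0"
      and close: "\<And>xp. dist xp (0, 0) < \<delta> \<Longrightarrow> dist (poisson f xp) (poisson f (0, 0)) < \<epsilon> * (1 - exp (- 1))"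
      using continuous_poisson[OF cont bdd, of "(0, 0)"] unfolding continuous_at_eps_delta by blast
    define R where "R = 2 / \<delta>"
    have R: "R > 0" "1 / R < \<delta>" using \<delta> by (simp_all add: R_def)
    have "measure (\<sigma> n) {- R<..R} > 1 - \<epsilon>" for n
    proof -
      interpret real_distribution "\<sigma> n" by (rule \<sigma>)
      define y where "y = real (Suc n) * (1 - exp (- (1 / R) / real (Suc n)))"
      \<comment> \<open>Yields \<open>y \<le> 1 / R\<close> for every \<open>n\<close>, so a single
        \<open>R\<close> serves all measures.\<close>
      have "exp (- (1 / R) / real (Suc n)) \<ge> 1 + - (1 / R) / real (Suc n)"
        by (rule exp_ge_add_one_self)
      then have "y \<le> real (Suc n) * ((1 / R) / real (Suc n))"
        unfolding y_def by (intro mult_left_mono) auto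
      also have "\<dots> = 1 / R" by simp
      finally have "y < \<delta>" using R by simp
      moreover have "y \<ge> 0"
        using R unfolding y_def by (intro mult_nonneg_nonneg) auto
      ultimately have "dist (poisson f (y, 0)) 1 < \<epsilon> * (1 - exp (- 1))"
        using close[of "(y, 0)"] by (simp add: dist_Pair_Pair poisson_0 f0)
      then have small: "1 - Re (poisson f (y, 0)) < \<epsilon> * (1 - exp (- 1))"
        using complex_Re_le_cmod[of "1 - poisson f (y, 0)"] by (simp add: dist_norm norm_minus_commute)
      have int: "integrable (\<sigma> n) (\<lambda>x. exp (- (1 / R) * \<bar>x\<bar>))"
        by (rule integrable_const_bound[where B = 1]) (use R in auto)
      have "(1 - exp (- 1)) * measure (\<sigma> n) {x. \<bar>x\<bar> \<ge> R} = (LINT x|\<sigma> n. (1 - exp (- 1)) * indicator {x. \<bar>x\<bar> \<ge> R} x)"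
        by simp
      also have "\<dots> \<le> (LINT x|\<sigma> n. 1 - exp (- (1 / R) * \<bar>x\<bar>))"
      proof (rule integral_mono)
        show "integrable (\<sigma> n) (\<lambda>x. 1 - exp (- (1 / R) * \<bar>x\<bar>))"
          using int by auto
        show "integrable (\<sigma> n) (\<lambda>x. (1 - exp (- 1)) * indicator {x. \<bar>x\<bar> \<ge> R} x)"
          by (intro integrable_mult_right integrable_const_bound[where B = 1]) (auto simp: indicator_def)
        show "(1 - exp (- 1)) * indicator {x. \<bar>x\<bar> \<ge> R} x \<le> 1 - exp (- (1 / R) * \<bar>x\<bar>)" for x
          using R by (auto simp: indicator_def field_simps)
      qed
      also have "\<dots> = 1 - (LINT x|\<sigma> n. exp (- (1 / R) * \<bar>x\<bar>))"
        using int prob_space by simp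
      also have "(LINT x|\<sigma> n. exp (- (1 / R) * \<bar>x\<bar>)) = Re (poisson f (y, 0))"
        using laplace[of "1 / R" n] R(1) unfolding y_def integral_complex_of_real
        by (metis Re_complex_of_real zero_less_divide_1_iff)
      finally have "(1 - exp (- 1)) * measure (\<sigma> n) {x. \<bar>x\<bar> \<ge> R} < (1 - exp (- 1)) * \<epsilon>"
        using small by (simp only: mult.commute[of \<epsilon>])
      then have "measure (\<sigma> n) {x. \<bar>x\<bar> \<ge> R} < \<epsilon>"
        by (rule mult_left_less_imp_less) simp
      moreover have "1 - measure (\<sigma> n) {x. \<bar>x\<bar> \<ge> R} = measure (\<sigma> n) (UNIV - {x. \<bar>x\<bar> \<ge> R})"
        using prob_compl[of "{x. \<bar>x\<bar> \<ge> R}"] by simp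
      moreover have "\<dots> \<le> measure (\<sigma> n) {- R<..R}"
        by (rule finite_measure_mono) auto
      ultimately show ?thesis by simp
    qed
    then show "\<exists>a b. a < b \<and> (\<forall>n. measure (\<sigma> n) {a<..b} > 1 - \<epsilon>)"
      using R by (intro exI[of _ "- R"] exI[of _ R]) auto
  qed
  from tight_imp_convergent_subsubsequence[OF this strict_mono_id]
  obtain r M where r: "strict_mono (r :: nat \<Rightarrow> nat)" and M: "real_distribution M"
    and conv: "weak_conv_m (\<sigma> \<circ> r) M" by auto
  have "f s = char M s" for s
  proof (rule LIMSEQ_unique)
    show "(\<lambda>n. char ((\<sigma> \<circ> r) n) s) \<longlonglongrightarrow> char M s"
      by (rule levy_continuity1[OF _ M conv]) (simp add: \<sigma>)
    have "(\<lambda>n. real (Suc n) * (1 - cos (s / real (Suc n)))) \<longlonglongrightarrow> 0"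
      by real_asymp
    moreover have "(\<lambda>n. real (Suc n) * sin (s / real (Suc n))) \<longlonglongrightarrow> s"
      by real_asymp
    ultimately have "(\<lambda>n. char (\<sigma> n) s) \<longlonglongrightarrow> poisson f (0, s)"
      unfolding char by (intro isCont_tendsto_compose[OF continuous_poisson[OF cont bdd]] tendsto_Pair)
    then show "(\<lambda>n. char ((\<sigma> \<circ> r) n) s) \<longlonglongrightarrow> f s"
      using LIMSEQ_subseq_LIMSEQ[OF _ r] by (auto simp: poisson_0 o_def)
  qed
  then show ?thesis
    using M unfolding is_characteristic_function_def by blast
qed

end

section \<open>Fourier inversion\<close>

text \<open>Rescaling by \<open>\<epsilon>\<close> reduces this to the characteristic function of
  the standard normal distribution.\<close>

lemma gaussian_Fourier:
  assumes "\<epsilon> > 0"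
  shows "(LINT t|lborel. iexp (t * x) * of_real (exp (- (\<epsilon> * t)\<^sup>2 / 2)))
    = of_real (sqrt (2 * pi) / \<epsilon> * exp (- (x / \<epsilon>)\<^sup>2 / 2))"
proof -
  have "(LINT t|lborel. iexp (t * x) * of_real (exp (- (\<epsilon> * t)\<^sup>2 / 2)))
      = (1 / \<epsilon>) *\<^sub>R (LINT v|lborel. iexp (v * (x / \<epsilon>)) * of_real (exp (- v\<^sup>2 / 2)))"
    using assms by (subst lborel_integral_real_affine[where c = "1 / \<epsilon>" and t = 0]) (simp_all add: field_simps)
  also have "(LINT v|lborel. iexp (v * (x / \<epsilon>)) * of_real (exp (- v\<^sup>2 / 2)))
      = (LINT v|lborel. of_real (sqrt (2 * pi)) * (std_normal_density v *\<^sub>R iexp (x / \<epsilon> * v)))"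
    by (intro Bochner_Integration.integral_cong) (auto simp: std_normal_density_def scaleR_conv_of_real mult_ac)
  also have "\<dots> = of_real (sqrt (2 * pi)) * char std_normal_distribution (x / \<epsilon>)"
    unfolding char_def by (subst integral_density) (simp_all only: integral_mult_right_zero, auto)
  also have "\<dots> = of_real (sqrt (2 * pi) * exp (- (x / \<epsilon>)\<^sup>2 / 2))"
    by (simp add: char_std_normal_distribution)
  finally show ?thesis
    by (simp add: scaleR_conv_of_real field_simps)
qed

lemma integrable_gaussian:
  assumes "\<epsilon> > 0"
  shows "integrable lborel (\<lambda>t::real. exp (- (\<epsilon> * t)\<^sup>2 / 2))"
proof -
  have "integrable lborel (\<lambda>t. std_normal_density t * sqrt (2 * pi))"
    by (intro integrable_mult_left integrable_normal_density) auto
  then have "integrable lborel (\<lambda>t::real. exp (- t\<^sup>2 / 2))"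
    by (simp add: std_normal_density_def)
  from lborel_integrable_real_affine[OF this, of \<epsilon> 0] assms show ?thesis by simp
qed

text \<open>Gaussian summation: damp the inverse integral by
  \<open>exp (- (\<epsilon> t)^2 / 2)\<close> and let \<open>\<epsilon>\<close> tend to 0. Directly,
  the damping disappears; after Fubini, the same quantity is an average of \<open>w\<close> near
  \<open>s\<close> against a narrowing normal density. The two limits must agree.\<close>

lemma Fourier_inversion:
  fixes w :: "real \<Rightarrow> complex"
  defines "W \<equiv> \<lambda>t. LINT u|lborel. w u * iexp (- (t * u))"
  assumes w: "integrable lborel w" and cont: "continuous_on UNIV w" and bdd: "\<And>u. norm (w u) \<le> C"
    and W: "integrable lborel W"
  shows "(LINT t|lborel. W t * iexp (t * s)) = 2 * of_real pi * w s"
proof (rule LIMSEQ_unique)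
  have [measurable]: "w \<in> borel_measurable borel"
    using cont by (rule borel_measurable_continuous_onI)
  have [measurable]: "W \<in> borel_measurable borel"
    using W by (auto dest: borel_measurable_integrable)
  define \<epsilon> where "\<epsilon> n = 1 / real (Suc n)" for n
  have \<epsilon>: "\<epsilon> n > 0" for n by (simp add: \<epsilon>_def)
  have \<epsilon>_lim: "\<epsilon> \<longlonglongrightarrow> 0"
    unfolding \<epsilon>_def[abs_def] by (rule LIMSEQ_Suc[OF lim_1_over_n])
  let ?A = "\<lambda>n. LINT t|lborel. W t * iexp (t * s) * of_real (exp (- (\<epsilon> n * t)\<^sup>2 / 2))"
  show "?A \<longlonglongrightarrow> (LINT t|lborel. W t * iexp (t * s))"
  proof (rule integral_dominated_convergence[where w = "\<lambda>t. norm (W t)"])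
    have "(\<lambda>n. W t * iexp (t * s) * of_real (exp (- (\<epsilon> n * t)\<^sup>2 / 2)))
        \<longlonglongrightarrow> W t * iexp (t * s) * of_real (exp (- (0 * t)\<^sup>2 / 2))" for t
      by (intro tendsto_intros \<epsilon>_lim) simp
    then show "AE t in lborel. (\<lambda>n. W t * iexp (t * s) * of_real (exp (- (\<epsilon> n * t)\<^sup>2 / 2)))
        \<longlonglongrightarrow> W t * iexp (t * s)"
      by simp
    show "AE t in lborel. norm (W t * iexp (t * s) * of_real (exp (- (\<epsilon> n * t)\<^sup>2 / 2))) \<le> norm (W t)" for n
      by (auto simp: norm_mult intro!: mult_left_le)
    show "integrable lborel (\<lambda>t. norm (W t))" using W by (rule integrable_norm)
  qed measurable
  have A: "?A n = 2 * of_real pi * (LINT v|lborel. of_real (std_normal_density v) * w (s + \<epsilon> n * v))" for n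
  proof -
    let ?g = "\<lambda>t. complex_of_real (exp (- (\<epsilon> n * t)\<^sup>2 / 2))"
    let ?h = "\<lambda>u t. w u * (iexp (t * (s - u)) * ?g t)"
    have "?A n = (LINT t|lborel. LINT u|lborel. ?h u t)"
    proof (rule Bochner_Integration.integral_cong[OF refl])
      fix t
      have "W t * iexp (t * s) * ?g t = (LINT u|lborel. w u * iexp (- (t * u)) * (iexp (t * s) * ?g t))"
        by (subst integral_mult_left_zero) (simp add: W_def mult.assoc)
      also have "\<dots> = (LINT u|lborel. ?h u t)"
      proof -
        have "iexp (t * (s - u)) = iexp (t * s) * iexp (- (t * u))" for u
          by (simp add: algebra_simps flip: exp_add)
        then show ?thesis by (simp add: mult_ac)
      qed
      finally show "W t * iexp (t * s) * ?g t = (LINT u|lborel. ?h u t)" .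
    qed
    also have "\<dots> = (LINT u|lborel. LINT t|lborel. ?h u t)"
    \<comment> \<open>The Gaussian factor gives integrability in \<open>t\<close> and
      \<open>w\<close> gives it in \<open>u\<close>; the undamped double integral would lack the
      former.\<close>
    proof (rule lborel_pair.Fubini_integral, rule lborel_pair.Fubini_integrable)
      have norm_h: "norm (?h u t) = norm (w u) * exp (- (\<epsilon> n * t)\<^sup>2 / 2)" for u t
        by (simp add: norm_mult)
      show "integrable lborel (\<lambda>u. LINT t|lborel. norm (case (u, t) of (u, t) \<Rightarrow> ?h u t))"
        unfolding prod.case norm_h integral_mult_right_zero
        by (intro integrable_mult_left integrable_norm w)
      have "integrable lborel (\<lambda>t. ?h u t)" for u
        by (rule Bochner_Integration.integrable_bound[OF integrable_mult_right[OF integrable_gaussian[OF \<epsilon>[of n]], of "norm (w u)"]])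
           (auto simp: norm_mult)
      then show "AE u in lborel. integrable lborel (\<lambda>t. case (u, t) of (u, t) \<Rightarrow> ?h u t)"
        by simp
    qed measurable
    also have "\<dots> = (LINT u|lborel. w u * of_real (sqrt (2 * pi) / \<epsilon> n * exp (- ((s - u) / \<epsilon> n)\<^sup>2 / 2)))"
      unfolding integral_mult_right_zero gaussian_Fourier[OF \<epsilon>] ..
    also have "\<dots> = \<epsilon> n *\<^sub>R (LINT v|lborel. w (s + \<epsilon> n * v) * of_real (sqrt (2 * pi) / \<epsilon> n * exp (- ((s - (s + \<epsilon> n * v)) / \<epsilon> n)\<^sup>2 / 2)))"
      using \<epsilon>[of n] by (subst lborel_integral_real_affine[where c = "\<epsilon> n" and t = s]) auto
    also have "\<dots> = (LINT v|lborel. \<epsilon> n *\<^sub>R (w (s + \<epsilon> n * v) * of_real (sqrt (2 * pi) / \<epsilon> n * exp (- ((s - (s + \<epsilon> n * v)) / \<epsilon> n)\<^sup>2 / 2))))"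
      by simp
    also have "\<dots> = (LINT v|lborel. 2 * of_real pi * (of_real (std_normal_density v) * w (s + \<epsilon> n * v)))"
    proof (rule Bochner_Integration.integral_cong[OF refl])
      fix v
      \<comment> \<open>Origin of the factor \<open>2 * pi\<close>: the Gaussian transform brings
        \<open>sqrt (2 * pi)\<close>, while the normal density is normalised by its
        reciprocal.\<close>
      have "2 * pi * std_normal_density v = 2 * pi / sqrt (2 * pi) * exp (- v\<^sup>2 / 2)"
        by (simp add: std_normal_density_def)
      also have "2 * pi / sqrt (2 * pi) = sqrt (2 * pi)"
        by (rule real_div_sqrt) simp
      finally have "\<epsilon> n * (sqrt (2 * pi) / \<epsilon> n * exp (- ((s - (s + \<epsilon> n * v)) / \<epsilon> n)\<^sup>2 / 2))
          = 2 * pi * std_normal_density v"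
        using \<epsilon>[of n] by simp
      moreover have "\<epsilon> n *\<^sub>R (w (s + \<epsilon> n * v) * of_real A) = of_real (\<epsilon> n * A) * w (s + \<epsilon> n * v)" for A
        by (simp add: scaleR_conv_of_real)
      ultimately have "\<epsilon> n *\<^sub>R (w (s + \<epsilon> n * v) * of_real (sqrt (2 * pi) / \<epsilon> n * exp (- ((s - (s + \<epsilon> n * v)) / \<epsilon> n)\<^sup>2 / 2)))
          = of_real (2 * pi * std_normal_density v) * w (s + \<epsilon> n * v)"
        by (simp only:)
      then show "\<epsilon> n *\<^sub>R (w (s + \<epsilon> n * v) * of_real (sqrt (2 * pi) / \<epsilon> n * exp (- ((s - (s + \<epsilon> n * v)) / \<epsilon> n)\<^sup>2 / 2)))
          = 2 * of_real pi * (of_real (std_normal_density v) * w (s + \<epsilon> n * v))"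
        by (simp only: of_real_mult of_real_numeral mult.assoc)
    qed
    finally show ?thesis by simp
  qed
  have "(\<lambda>n. LINT v|lborel. of_real (std_normal_density v) * w (s + \<epsilon> n * v))
      \<longlonglongrightarrow> (LINT v|lborel. of_real (std_normal_density v) * w s)"
  proof (rule integral_dominated_convergence[where w = "\<lambda>v. std_normal_density v * C"])
    have "(\<lambda>n. w (s + \<epsilon> n * v)) \<longlonglongrightarrow> w (s + 0 * v)" for v
      by (intro continuous_on_tendsto_compose[OF cont] tendsto_intros \<epsilon>_lim) auto
    then show "AE v in lborel. (\<lambda>n. of_real (std_normal_density v) * w (s + \<epsilon> n * v))
        \<longlonglongrightarrow> of_real (std_normal_density v) * w s"
      by (intro AE_I2 tendsto_mult tendsto_const) simp
    show "AE v in lborel. norm (of_real (std_normal_density v) * w (s + \<epsilon> n * v)) \<le> std_normal_density v * C" for n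
      using bdd by (auto simp: norm_mult intro!: mult_left_mono)
    show "integrable lborel (\<lambda>v. std_normal_density v * C)"
      by (intro integrable_mult_left integrable_normal_density) auto
  qed measurable
  moreover have "(LINT v|lborel. of_real (std_normal_density v) * w s) = w s"
    by (subst integral_mult_left_zero, subst integral_complex_of_real, subst integral_normal_density) auto
  ultimately show "?A \<longlonglongrightarrow> 2 * of_real pi * w s"
    unfolding A by (auto intro!: tendsto_intros)
qed

section \<open>Necessity\<close>

lemma Laplace_exp:
  assumes "Re z > 0"
  shows "integrable lborel (\<lambda>u. indicator {0<..} u *\<^sub>R exp (- z * of_real u))"
    and "(LINT u|lborel. indicator {0<..} u *\<^sub>R exp (- z * of_real u)) = 1 / z"
proof -
  have e: "einterval 0 \<infinity> = {0<..}" by (auto simp: einterval_def)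
  have nz: "z \<noteq> 0" using assms by auto
  show int: "integrable lborel (\<lambda>u. indicator {0<..} u *\<^sub>R exp (- z * of_real u))"
  proof (rule Bochner_Integration.integrable_bound)
    show "integrable lborel (\<lambda>u. indicator {0<..} u *\<^sub>R exp (- (u * Re z)))"
      using integrable_I0i_exp_mscale[OF assms] by (simp add: set_integrable_def)
  qed (auto simp: indicator_def mult.commute)
  have "(LBINT u=0..\<infinity>. exp (- z * of_real u)) = 0 - (- 1 / z)"
  proof (rule interval_integral_FTC_integrable[where F = "\<lambda>u. - exp (- z * of_real u) / z"])
    show "((\<lambda>u. - exp (- z * of_real u) / z) has_vector_derivative exp (- z * of_real u)) (at u)" for u
      using nz by (auto intro!: derivative_eq_intros has_vector_derivative_real_field simp: field_simps)
    show "(((\<lambda>u. - exp (- z * complex_of_real u) / z) \<circ> real_of_ereal) \<longlongrightarrow> - 1 / z) (at_right 0)"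
      unfolding zero_ereal_def ereal_tendsto_simps
      by (auto simp: nz intro!: tendsto_eq_intros)
    have "((\<lambda>u. exp (- (Re z * u))) \<longlongrightarrow> 0) at_top"
      using assms by real_asymp
    then have "((\<lambda>u. norm (exp (- z * complex_of_real u))) \<longlongrightarrow> 0) at_top"
      by simp
    then have "((\<lambda>u. exp (- z * complex_of_real u)) \<longlongrightarrow> 0) at_top"
      by (rule tendsto_norm_zero_cancel)
    then have "((\<lambda>u. - exp (- z * complex_of_real u) / z) \<longlongrightarrow> - 0 / z) at_top"
      using assms by (intro tendsto_intros) auto
    then show "(((\<lambda>u. - exp (- z * complex_of_real u) / z) \<circ> real_of_ereal) \<longlongrightarrow> 0) (at_left \<infinity>)"
      unfolding ereal_tendsto_simps by simp
    show "set_integrable lborel (einterval 0 \<infinity>) (\<lambda>u. exp (- z * complex_of_real u))"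
      using int by (simp add: set_integrable_def e)
  qed auto
  then show "(LINT u|lborel. indicator {0<..} u *\<^sub>R exp (- z * of_real u)) = 1 / z"
    by (simp add: interval_lebesgue_integral_def set_lebesgue_integral_def e)
qed

text \<open>The continuous function whose Fourier transform is the Cauchy kernel at \<open>\<i> y\<close>, up to the
  factor \<open>2 \<i>\<close>.\<close>

definition cauchy_preimage :: "real \<Rightarrow> real \<Rightarrow> real" where
  "cauchy_preimage y u = (if u \<ge> 0 then 2 * exp (- y * u) - exp (- u) else exp u)"

text \<open>The two branches meet at 0, since \<open>2 - 1 = 1\<close>. Pointwise Fourier inversion
  relies on this.\<close>

lemma continuous_cauchy_preimage: "continuous_on UNIV (cauchy_preimage y)"
proof -
  have "continuous_on ({0..} \<union> {..0}) (\<lambda>u. if u \<ge> 0 then 2 * exp (- y * u) - exp (- u) else exp u)"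
    by (rule continuous_on_If) (auto intro!: continuous_intros)
  moreover have "{0..} \<union> {..0} = (UNIV :: real set)" by auto
  ultimately show ?thesis
    unfolding cauchy_preimage_def[abs_def] by simp
qed

lemma abs_cauchy_preimage_le:
  assumes "y > 0"
  shows "\<bar>cauchy_preimage y u\<bar> \<le> 2"
proof (cases "u \<ge> 0")
  case True
  then have "exp (- y * u) \<le> 1" "exp (- u) \<le> 1" "exp (- y * u) > 0" "exp (- u) > 0"
    using assms by auto
  then have "\<bar>2 * exp (- y * u) - exp (- u)\<bar> \<le> 2" by linarith
  then show ?thesis using True by (simp add: cauchy_preimage_def)
next
  case False
  then have "exp u \<le> 1" by simp
  then have "exp u \<le> 2" by linarith
  then show ?thesis using False by (simp add: cauchy_preimage_def)
qed

text \<open>Away from 0 the function is a combination of one-sided exponentials with transforms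
  \<open>1 / (y + \<i> t)\<close>, \<open>1 / (1 + \<i> t)\<close> and
  \<open>1 / (1 - \<i> t)\<close>. The first gives the Cauchy kernel, the other two combine to the
  correction \<open>t / (t^2 + 1)\<close>.\<close>

lemma
  assumes y: "y > 0"
  shows integrable_cauchy_preimage: "integrable lborel (\<lambda>u. complex_of_real (cauchy_preimage y u))"
    and Fourier_cauchy_preimage:
      "(LINT u|lborel. of_real (cauchy_preimage y u) * iexp (- (t * u)))
        = 2 * \<i> * (1 / (\<i> * of_real y - of_real t) + of_real (t / (t\<^sup>2 + 1)))"
proof -
  define E where "E z u = indicator {0<..} u *\<^sub>R exp (- z * complex_of_real u)" for z u
  have E: "integrable lborel (E z)" "integral\<^sup>L lborel (E z) = 1 / z"
    and E': "integrable lborel (\<lambda>u. E z (- u))" "(LINT u|lborel. E z (- u)) = 1 / z" if "Re z > 0" for z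
  proof -
    show *: "integrable lborel (E z)" "integral\<^sup>L lborel (E z) = 1 / z"
      unfolding E_def[abs_def] using Laplace_exp[OF that] by auto
    show "integrable lborel (\<lambda>u. E z (- u))" "(LINT u|lborel. E z (- u)) = 1 / z"
      using lborel_integrable_real_affine[OF *(1), of "-1" 0] lborel_integral_real_affine[of "-1" "E z" 0] *(2)
      by simp_all
  qed
  have meas: "(\<lambda>u. of_real (cauchy_preimage y u) * iexp (- (t * u))) \<in> borel_measurable borel" for t
    by (intro borel_measurable_continuous_onI continuous_intros continuous_cauchy_preimage)
  define V where "V t u = 2 * E (of_real y + \<i> * of_real t) u - E (1 + \<i> * of_real t) u
      + E (1 - \<i> * of_real t) (- u)" for t u
  \<comment> \<open>At \<open>u = 0\<close> the left side is 1 and the right side 0, hence equality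
    only almost everywhere.\<close>
  have V: "of_real (cauchy_preimage y u) * iexp (- (t * u)) = V t u" if "u \<noteq> 0" for t u
  proof (cases "u > 0")
    case True
    then show ?thesis
      by (simp add: V_def E_def cauchy_preimage_def algebra_simps exp_add[symmetric] exp_of_real[symmetric])
  next
    case False
    then show ?thesis
      using that by (simp add: V_def E_def cauchy_preimage_def algebra_simps exp_add[symmetric] exp_of_real[symmetric])
  qed
  have AE: "AE u in lborel. of_real (cauchy_preimage y u) * iexp (- (t * u)) = V t u" for t
    using AE_lborel_singleton[of "0::real"] by eventually_elim (rule V)
  have int_V: "integrable lborel (V t)" for t
    unfolding V_def[abs_def]
    using y by (intro Bochner_Integration.integrable_add Bochner_Integration.integrable_diff integrable_mult_right E E') auto
  then have "integrable lborel (\<lambda>u. of_real (cauchy_preimage y u) * iexp (- (t * u)))" for t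
    using AE[of t] meas[of t] by (subst integrable_cong_AE) auto
  from this[of 0] show "integrable lborel (\<lambda>u. complex_of_real (cauchy_preimage y u))" by simp
  have "(LINT u|lborel. of_real (cauchy_preimage y u) * iexp (- (t * u))) = integral\<^sup>L lborel (V t)"
    using AE[of t] meas[of t] int_V[of t] by (intro integral_cong_AE) auto
  also have "\<dots> = 2 * (1 / (of_real y + \<i> * of_real t)) - 1 / (1 + \<i> * of_real t) + 1 / (1 - \<i> * of_real t)"
    unfolding V_def using y by (simp add: E E')
  also have "\<dots> = 2 * \<i> * (1 / (\<i> * of_real y - of_real t) + of_real (t / (t\<^sup>2 + 1)))"
  proof -
    have nz: "of_real y + \<i> * of_real t \<noteq> 0" "1 + \<i> * of_real t \<noteq> 0" "1 - \<i> * of_real t \<noteq> 0"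
      "complex_of_real (t\<^sup>2 + 1) \<noteq> 0"
      using y by (auto simp: complex_eq_iff add_nonneg_eq_0_iff simp del: of_real_add of_real_power)
    have "\<i> * of_real y - of_real t = \<i> * (of_real y + \<i> * of_real t)"
      by (simp add: algebra_simps)
    then have "2 * \<i> * (1 / (\<i> * of_real y - of_real t)) = 2 * (1 / (of_real y + \<i> * of_real t))"
      by simp
    moreover have "1 / (1 - \<i> * of_real t) - 1 / (1 + \<i> * of_real t) = 2 * \<i> * of_real (t / (t\<^sup>2 + 1))"
    proof -
      have "complex_of_real (t\<^sup>2 + 1) = (1 - \<i> * of_real t) * (1 + \<i> * of_real t)"
        by (simp add: algebra_simps power2_eq_square)
      then show ?thesis
        using nz by (simp add: field_simps del: of_real_add)
    qed
    ultimately show ?thesis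
      unfolding distrib_left by (simp add: algebra_simps)
  qed
  finally show "(LINT u|lborel. of_real (cauchy_preimage y u) * iexp (- (t * u)))
        = 2 * \<i> * (1 / (\<i> * of_real y - of_real t) + of_real (t / (t\<^sup>2 + 1)))" .
qed

text \<open>Fubini moves the integral over \<open>M\<close> outside; the inner integral is then the
  inverse Fourier transform of the kernel, known from \<open>cauchy_preimage\<close>.\<close>

lemma modified_cauchy_char:
  assumes M: "real_distribution M" and y: "y > 0"
  shows "modified_cauchy (char M) (\<i> * of_real y) = of_real (LINT s|M. cauchy_preimage y s)"
proof -
  interpret real_distribution M by (rule M)
  interpret P: pair_sigma_finite M lborel ..
  define W where "W t = 1 / (\<i> * of_real y - of_real t) + complex_of_real (t / (t\<^sup>2 + 1))" for t
  \<comment> \<open>Integrability of the kernel itself is the case of the constant function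
    1.\<close>
  interpret one: bounded_continuous "\<lambda>_. 1" 1
    by standard auto
  have W: "integrable lborel W"
    unfolding W_def[abs_def] using one.integrable_modified_cauchy[of "\<i> * of_real y"] y by simp
  then have [measurable]: "W \<in> borel_measurable borel"
    by (auto dest: borel_measurable_integrable)
  have inv: "(LINT t|lborel. W t * iexp (t * s)) = of_real pi / \<i> * of_real (cauchy_preimage y s)" for s
  proof -
    have "(LINT t|lborel. (2 * \<i> * W t) * iexp (t * s)) = 2 * of_real pi * of_real (cauchy_preimage y s)"
      using Fourier_inversion[of "\<lambda>u. of_real (cauchy_preimage y u)" 2 s]
        integrable_cauchy_preimage[OF y] continuous_cauchy_preimage[of y] abs_cauchy_preimage_le[OF y] W
      unfolding Fourier_cauchy_preimage[OF y] W_def[symmetric]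
      by (auto intro: continuous_on_of_real)
    then have "2 * \<i> * (LINT t|lborel. W t * iexp (t * s)) = 2 * of_real pi * of_real (cauchy_preimage y s)"
      by (simp only: mult.assoc integral_mult_right_zero)
    moreover have "X = of_real pi / \<i> * c" if "2 * \<i> * X = 2 * of_real pi * c" for X c :: complex
    proof -
      have "X = (2 * \<i> * X) / (2 * \<i>)" by simp
      then show ?thesis unfolding that by simp
    qed
    ultimately show ?thesis by blast
  qed
  have "modified_cauchy (char M) (\<i> * of_real y) = \<i> / of_real pi * (LINT t|lborel. W t * char M t)"
    by (simp add: modified_cauchy_def W_def)
  also have "(LINT t|lborel. W t * char M t) = (LINT t|lborel. LINT s|M. W t * iexp (t * s))"
    unfolding char_def by simp
  also have "\<dots> = (LINT s|M. LINT t|lborel. W t * iexp (t * s))"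
  proof (rule P.Fubini_integral, rule P.Fubini_integrable)
    have n: "norm (W t * iexp (t * s)) = norm (W t)" for t s
      by (simp add: norm_mult)
    show "integrable M (\<lambda>s. LINT t|lborel. norm (case (s, t) of (s, t) \<Rightarrow> W t * iexp (t * s)))"
      unfolding prod.case n by simp
    show "AE s in M. integrable lborel (\<lambda>t. case (s, t) of (s, t) \<Rightarrow> W t * iexp (t * s))"
      unfolding prod.case by (intro AE_I2 Bochner_Integration.integrable_bound[OF W]) (auto simp: norm_mult)
  qed measurable
  also have "\<dots> = of_real pi / \<i> * of_real (LINT s|M. cauchy_preimage y s)"
    unfolding inv integral_mult_right_zero integral_complex_of_real ..
  finally show ?thesis by simp
qed

text \<open>The kernel is odd under \<open>(z, t) \<mapsto> (- z, - t)\<close>. This reduces the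
  lower imaginary half-axis to the upper one.\<close>

lemma modified_cauchy_uminus:
  "modified_cauchy f (- z) = - modified_cauchy (\<lambda>t. f (- t)) z"
proof -
  have "(LINT t|lborel. (1 / (- z - of_real t) + of_real (t / (t\<^sup>2 + 1))) * f t)
      = (LINT t|lborel. (1 / (- z - of_real (- t)) + of_real (- t / ((- t)\<^sup>2 + 1))) * f (- t))"
    using lborel_integral_real_affine[of "-1" "\<lambda>t. (1 / (- z - of_real t) + of_real (t / (t\<^sup>2 + 1))) * f t" 0]
    by simp
  also have "\<dots> = (LINT t|lborel. - ((1 / (z - of_real t) + of_real (t / (t\<^sup>2 + 1))) * f (- t)))"
  proof -
    have "1 / (- z - of_real (- t)) = - (1 / (z - of_real t))" for t
      by (metis minus_diff_minus minus_divide_right of_real_minus)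
    then show ?thesis by (simp add: algebra_simps)
  qed
  also have "\<dots> = - (LINT t|lborel. (1 / (z - of_real t) + of_real (t / (t\<^sup>2 + 1))) * f (- t))"
    by (rule integral_minus)
  finally show ?thesis
    by (simp add: modified_cauchy_def)
qed

section \<open>Laplace integrals and complete monotonicity\<close>

lemma power_mult_exp_minus_le:
  fixes x d :: real
  assumes "x \<ge> 0" "d > 0"
  shows "x ^ n * exp (- d * x) \<le> fact n / d ^ n"
proof -
  \<comment> \<open>A single term of the exponential series, written as a sum over a singleton so
    that \<open>sum_le_suminf\<close> applies.\<close>
  have "(\<Sum>k\<in>{n}. (d * x) ^ k /\<^sub>R fact k) \<le> exp (d * x)"
    unfolding exp_def using assms summable_exp_generic[of "d * x"]
    by (intro sum_le_suminf) auto
  then have "d ^ n * x ^ n \<le> fact n * exp (d * x)"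
    by (simp add: power_mult_distrib field_simps)
  then show ?thesis
    using assms by (simp add: field_simps exp_minus)
qed

text \<open>Each differentiation under the integral brings down a factor
  \<open>- \<bar>s\<bar>\<close>, whose sign alternates as required.\<close>

lemma completely_monotonic_Laplace:
  assumes M: "real_distribution M" and g: "g \<in> borel_measurable borel"
    and bounds: "\<And>s. 0 \<le> g s" "\<And>s. g s \<le> C"
  shows "completely_monotonic_on (\<lambda>y. LINT s|M. g s * exp (- y * \<bar>s\<bar>)) {0<..}"
proof -
  interpret real_distribution M by (rule M)
  note [measurable] = g
  define D where "D n y = (LINT s|M. g s * (- \<bar>s\<bar>) ^ n * exp (- y * \<bar>s\<bar>))" for n y
  have bound: "norm (g s * (- \<bar>s\<bar>) ^ n * exp (- y * \<bar>s\<bar>)) \<le> C * (fact n / d ^ n)"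
    if "d > 0" "d \<le> y" for n d y s
  proof -
    have "norm (g s * (- \<bar>s\<bar>) ^ n * exp (- y * \<bar>s\<bar>)) = g s * (\<bar>s\<bar> ^ n * exp (- y * \<bar>s\<bar>))"
      using bounds[of s] by (simp add: abs_mult power_abs)
    also have "\<bar>s\<bar> ^ n * exp (- y * \<bar>s\<bar>) \<le> \<bar>s\<bar> ^ n * exp (- d * \<bar>s\<bar>)"
      using that by (intro mult_left_mono) (auto intro: mult_right_mono)
    also have "\<dots> \<le> fact n / d ^ n"
      by (rule power_mult_exp_minus_le) (use that in auto)
    finally have "norm (g s * (- \<bar>s\<bar>) ^ n * exp (- y * \<bar>s\<bar>)) \<le> g s * (fact n / d ^ n)"
      using bounds[of s] by (simp add: mult_left_mono)
    also have "\<dots> \<le> C * (fact n / d ^ n)"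
      using bounds[of s] that by (intro mult_right_mono) auto
    finally show ?thesis .
  qed
  have int: "integrable M (\<lambda>s. g s * (- \<bar>s\<bar>) ^ n * exp (- y * \<bar>s\<bar>))" if "y > 0" for n y
    by (rule integrable_const_bound[where B = "C * (fact n / y ^ n)"]) (use bound[of y y] that in auto)
  have "(D n has_real_derivative D (Suc n) y) (at y)" if y: "y > 0" for n y
    unfolding D_def
  \<comment> \<open>On this ball \<open>x \<ge> y / 2\<close>, so \<open>bound\<close> with
    \<open>d = y / 2\<close> gives a constant majorant, integrable for a probability
    measure.\<close>
  proof (rule has_field_derivative_integral[where r = "y / 2"])
    fix x assume "x \<in> ball y (y / 2)"
    then have x: "x > 0" "x \<ge> y / 2"
      using y by (auto simp: dist_real_def abs_if split: if_splits)
    show "integrable M (\<lambda>s. g s * (- \<bar>s\<bar>) ^ n * exp (- x * \<bar>s\<bar>))" using x by (intro int)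
    show "((\<lambda>x. g s * (- \<bar>s\<bar>) ^ n * exp (- x * \<bar>s\<bar>)) has_field_derivative
        g s * (- \<bar>s\<bar>) ^ Suc n * exp (- x * \<bar>s\<bar>)) (at x)" for s
      by (auto intro!: derivative_eq_intros)
    show "norm (g s * (- \<bar>s\<bar>) ^ Suc n * exp (- x * \<bar>s\<bar>)) \<le> C * (fact (Suc n) / (y / 2) ^ Suc n)" for s
      by (rule bound) (use x y in auto)
  qed (use y in auto)
  moreover have "(-1) ^ n * D n y \<ge> 0" for n y
  proof -
    have "(-1) ^ n * D n y = (LINT s|M. (-1) ^ n * (g s * (- \<bar>s\<bar>) ^ n * exp (- y * \<bar>s\<bar>)))"
      unfolding D_def by simp
    also have "\<dots> = (LINT s|M. g s * \<bar>s\<bar> ^ n * exp (- y * \<bar>s\<bar>))"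
    proof (rule Bochner_Integration.integral_cong[OF refl])
      fix s
      have "(-1) ^ n * (g s * (- \<bar>s\<bar>) ^ n * exp (- y * \<bar>s\<bar>))
          = g s * ((-1) ^ n * (- \<bar>s\<bar>) ^ n) * exp (- y * \<bar>s\<bar>)"
        by (simp only: mult_ac)
      also have "(-1) ^ n * (- \<bar>s\<bar>) ^ n = \<bar>s\<bar> ^ n"
        by (simp flip: power_mult_distrib)
      finally show "(-1) ^ n * (g s * (- \<bar>s\<bar>) ^ n * exp (- y * \<bar>s\<bar>)) = g s * \<bar>s\<bar> ^ n * exp (- y * \<bar>s\<bar>)" .
    qed
    also have "\<dots> \<ge> 0"
      using bounds by (intro Bochner_Integration.integral_nonneg) auto
    finally show ?thesis .
  qed
  moreover have "D 0 y = (LINT s|M. g s * exp (- y * \<bar>s\<bar>))" for y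
    by (simp add: D_def)
  ultimately show ?thesis
    unfolding completely_monotonic_on_def by (intro exI[of _ D]) auto
qed

lemma completely_monotonic_on_cong:
  assumes "\<And>x. x \<in> S \<Longrightarrow> f x = g x"
  shows "completely_monotonic_on f S \<longleftrightarrow> completely_monotonic_on g S"
  using assms by (simp add: completely_monotonic_on_def)

lemma char_distr_uminus:
  assumes "real_distribution M"
  shows "char (distr M borel uminus) t = char M (- t)"
proof -
  interpret real_distribution M by fact
  show ?thesis
    unfolding char_def by (subst integral_distr) auto
qed

text \<open>The correction term of the kernel contributes
  \<open>- sgn s * exp (- \<bar>s\<bar>)\<close> to \<open>cauchy_preimage\<close>. It does not
  depend on \<open>y\<close>, so the constant \<open>a\<close> removes it on both half-axes. An atom
  of \<open>M\<close> at 0 is shared equally, as \<open>sgn 0 = 0\<close>.\<close>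

lemma modified_cauchy_char_shifted:
  assumes M: "real_distribution M" and y: "y > 0"
  defines "a \<equiv> LINT s|M. sgn s * exp (- \<bar>s\<bar>)"
  shows "of_real a + modified_cauchy (char M) (\<i> * of_real y)
      = of_real (LINT s|M. (1 + sgn s) * exp (- y * \<bar>s\<bar>))" (is ?pos)
    and "of_real a + modified_cauchy (char M) (\<i> * of_real (- y))
      = - of_real (LINT s|M. (1 - sgn s) * exp (- y * \<bar>s\<bar>))" (is ?neg)
proof -
  interpret real_distribution M by (rule M)
  have [measurable]: "cauchy_preimage y \<in> borel_measurable borel"
    by (rule borel_measurable_continuous_onI[OF continuous_cauchy_preimage])
  have [measurable]: "(sgn :: real \<Rightarrow> real) \<in> borel_measurable borel"
    unfolding sgn_real_def[abs_def] by measurable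
  have int_a: "integrable M (\<lambda>s. sgn s * exp (- \<bar>s\<bar>))"
    by (rule integrable_const_bound[where B = 1]) (auto simp: abs_mult sgn_real_def)
  have int_w: "integrable M (\<lambda>s. cauchy_preimage y s)" "integrable M (\<lambda>s. cauchy_preimage y (- s))"
    by (rule integrable_const_bound[where B = 2]; use abs_cauchy_preimage_le[OF y] in auto)+
  have split: "sgn s * exp (- \<bar>s\<bar>) + cauchy_preimage y s = (1 + sgn s) * exp (- y * \<bar>s\<bar>)" for s
    by (auto simp: cauchy_preimage_def sgn_real_def)
  have "a + (LINT s|M. cauchy_preimage y s) = (LINT s|M. (1 + sgn s) * exp (- y * \<bar>s\<bar>))"
    unfolding a_def split[symmetric] using int_a int_w by simp
  then show ?pos
    by (simp only: modified_cauchy_char[OF M y] flip: of_real_add)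
  \<comment> \<open>Reflecting the argument of the characteristic function amounts to reflecting the
    measure, so the formula for positive \<open>y\<close> applies again.\<close>
  have refl: "real_distribution (distr M borel uminus)"
    by (intro real_distribution_distr) auto
  have "modified_cauchy (char M) (- (\<i> * of_real y)) = - modified_cauchy (char (distr M borel uminus)) (\<i> * of_real y)"
    unfolding modified_cauchy_uminus char_distr_uminus[OF M, abs_def] ..
  also have "\<dots> = - of_real (LINT s|M. cauchy_preimage y (- s))"
    unfolding modified_cauchy_char[OF refl y] by (subst integral_distr) auto
  finally have neg: "modified_cauchy (char M) (\<i> * of_real (- y)) = - of_real (LINT s|M. cauchy_preimage y (- s))"
    by simp
  have split': "(1 - sgn s) * exp (- y * \<bar>s\<bar>) = cauchy_preimage y (- s) - sgn s * exp (- \<bar>s\<bar>)" for s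
    using split[of "- s"] by (simp add: sgn_minus)
  have "(LINT s|M. (1 - sgn s) * exp (- y * \<bar>s\<bar>)) = (LINT s|M. cauchy_preimage y (- s)) - a"
    unfolding a_def split' using int_a int_w by simp
  then show ?neg
    unfolding neg by simp
qed

theorem theorem2:
  fixes f :: "real \<Rightarrow> complex"
  assumes "continuous_on UNIV f"
    and "bounded (range f)"
    and "f 0 = 1"
  shows "is_characteristic_function f \<longleftrightarrow>
    (\<exists>a::real.
       (\<forall>y>0. Im (of_real a + modified_cauchy f (\<i> * of_real y)) = 0) \<and>
       completely_monotonic_on (\<lambda>y. Re (of_real a + modified_cauchy f (\<i> * of_real y))) {0<..} \<and>
       (\<forall>y<0. Im (of_real a + modified_cauchy f (\<i> * of_real y)) = 0) \<and>
       absolutely_monotonic_on (\<lambda>y. - Re (of_real a + modified_cauchy f (\<i> * of_real y))) {..<0})"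
proof
  assume "is_characteristic_function f"
  then obtain M where M: "real_distribution M" and f: "f = char M"
    unfolding is_characteristic_function_def by auto
  define a where "a = (LINT s|M. sgn s * exp (- \<bar>s\<bar>))"
  note pos = modified_cauchy_char_shifted(1)[OF M, folded a_def f]
    and neg = modified_cauchy_char_shifted(2)[OF M, folded a_def f]
  have meas: "(sgn :: real \<Rightarrow> real) \<in> borel_measurable borel"
    unfolding sgn_real_def[abs_def] by measurable
  have refl: "uminus ` {..<0} = {0::real<..}"
    by auto
  show "\<exists>a::real.
       (\<forall>y>0. Im (of_real a + modified_cauchy f (\<i> * of_real y)) = 0) \<and>
       completely_monotonic_on (\<lambda>y. Re (of_real a + modified_cauchy f (\<i> * of_real y))) {0<..} \<and>
       (\<forall>y<0. Im (of_real a + modified_cauchy f (\<i> * of_real y)) = 0) \<and>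
       absolutely_monotonic_on (\<lambda>y. - Re (of_real a + modified_cauchy f (\<i> * of_real y))) {..<0}"
  proof (intro exI[of _ a] conjI allI impI)
    show "Im (of_real a + modified_cauchy f (\<i> * of_real y)) = 0" if "y > 0" for y
      unfolding pos[OF that] by simp
    show "Im (of_real a + modified_cauchy f (\<i> * of_real y)) = 0" if "y < 0" for y
      using neg[of "- y"] that by simp
    show "completely_monotonic_on (\<lambda>y. Re (of_real a + modified_cauchy f (\<i> * of_real y))) {0<..}"
    proof (subst completely_monotonic_on_cong)
      show "Re (of_real a + modified_cauchy f (\<i> * of_real y)) = (LINT s|M. (1 + sgn s) * exp (- y * \<bar>s\<bar>))"
        if "y \<in> {0<..}" for y
        using pos[of y] that by simp
      show "completely_monotonic_on (\<lambda>y. LINT s|M. (1 + sgn s) * exp (- y * \<bar>s\<bar>)) {0<..}"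
        by (rule completely_monotonic_Laplace[OF M, where C = 2]) (use meas in \<open>auto simp: sgn_real_def\<close>)
    qed
    show "absolutely_monotonic_on (\<lambda>y. - Re (of_real a + modified_cauchy f (\<i> * of_real y))) {..<0}"
      unfolding absolutely_monotonic_on_def refl
    proof (subst completely_monotonic_on_cong)
      show "- Re (of_real a + modified_cauchy f (\<i> * of_real (- y))) = (LINT s|M. (1 - sgn s) * exp (- y * \<bar>s\<bar>))"
        if "y \<in> {0<..}" for y
        using neg[of y] that by simp
      show "completely_monotonic_on (\<lambda>y. LINT s|M. (1 - sgn s) * exp (- y * \<bar>s\<bar>)) {0<..}"
        by (rule completely_monotonic_Laplace[OF M, where C = 2]) (use meas in \<open>auto simp: sgn_real_def\<close>)
    qed
  qed
next
  assume "\<exists>a::real.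
       (\<forall>y>0. Im (of_real a + modified_cauchy f (\<i> * of_real y)) = 0) \<and>
       completely_monotonic_on (\<lambda>y. Re (of_real a + modified_cauchy f (\<i> * of_real y))) {0<..} \<and>
       (\<forall>y<0. Im (of_real a + modified_cauchy f (\<i> * of_real y)) = 0) \<and>
       absolutely_monotonic_on (\<lambda>y. - Re (of_real a + modified_cauchy f (\<i> * of_real y))) {..<0}"
  then obtain a :: real where a:
    "\<And>y. y > 0 \<Longrightarrow> Im (of_real a + modified_cauchy f (\<i> * of_real y)) = 0"
    "completely_monotonic_on (\<lambda>y. Re (of_real a + modified_cauchy f (\<i> * of_real y))) {0<..}"
    "\<And>y. y < 0 \<Longrightarrow> Im (of_real a + modified_cauchy f (\<i> * of_real y)) = 0"
    "absolutely_monotonic_on (\<lambda>y. - Re (of_real a + modified_cauchy f (\<i> * of_real y))) {..<0}"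
    by blast
  obtain B where "\<And>t. norm (f t) \<le> B"
    using assms(2) by (auto simp: bounded_iff)
  then interpret bounded_continuous f B
    using assms(1) by unfold_locales
  \<comment> \<open>The scale \<open>N\<close> runs through \<open>Suc n\<close>, which keeps it
    positive and lets it tend to infinity.\<close>
  have "\<forall>n. \<exists>\<sigma>. real_distribution \<sigma> \<and>
      (\<forall>s. char \<sigma> s = poisson f (real (Suc n) * (1 - cos (s / real (Suc n))), real (Suc n) * sin (s / real (Suc n)))) \<and>
      (\<forall>l>0. (LINT x|\<sigma>. complex_of_real (exp (- l * \<bar>x\<bar>))) = poisson f (real (Suc n) * (1 - exp (- l / real (Suc n))), 0))"
  proof
    fix n
    show "\<exists>\<sigma>. real_distribution \<sigma> \<and>
      (\<forall>s. char \<sigma> s = poisson f (real (Suc n) * (1 - cos (s / real (Suc n))), real (Suc n) * sin (s / real (Suc n)))) \<and>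
      (\<forall>l>0. (LINT x|\<sigma>. complex_of_real (exp (- l * \<bar>x\<bar>))) = poisson f (real (Suc n) * (1 - exp (- l / real (Suc n))), 0))"
      by (rule discretization[OF assms(3) a, of "real (Suc n)"]) auto
  qed
  then obtain \<sigma> where "\<And>n. real_distribution (\<sigma> n)"
    and "\<And>n s. char (\<sigma> n) s = poisson f (real (Suc n) * (1 - cos (s / real (Suc n))), real (Suc n) * sin (s / real (Suc n)))"
    and "\<And>n l. l > 0 \<Longrightarrow> (LINT x|\<sigma> n. complex_of_real (exp (- l * \<bar>x\<bar>)))
      = poisson f (real (Suc n) * (1 - exp (- l / real (Suc n))), 0)"
    by metis
  then show "is_characteristic_function f"
    using assms(3) by (rule characteristic_if_limit[rotated])
qed

end
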